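(* Let $G$ be a diamond-free graph. Then $G$ is clique-perfect if and only if no induced subgraph of $G$ is an odd hole or a sunoid.
   Context: A graph is diamond-free if it has no induced subgraph isomorphic to $K_4$ minus an edge. An odd hole is an induced cycle of odd length at least $5$. A clique-transversal of $G$ is a set of vertices meeting every maximal clique; $\tau_c(G)$ is its minimum size. A clique-independent set is a collection of pairwise vertex-disjoint maximal cliques; $\alpha_c(G)$ is its maximum size. $G$ is clique-perfect if $\tau_c(G')=\alpha_c(G')$ for every induced subgraph $G'$. A multisun is a diamond-free graph $G$ of odd order whose maximal cliques of size $2$ form the edge set of a Hamiltonian cycle $C$ of $G$ (the rim); all other maximal cliques consist of pairwise nonconsecutive vertices of $C$ and are called inscribed cliques. A sub-multisun of $G$ is obtained by deleting the edge sets of some, but not all, inscribed cliques. For inscribed cliques $A,B$ (not necessarily distinct), an $AB$-path is a subpath of $C$ with one endpoint in $A$ and the other in $B$ whose internal vertices lie in no inscribed clique; an $A$-path is an $AA$-path; for $v\in B$ an $Av$-path is an $AB$-path whose endpoint in $B$ is $v$. A multisun satisfies the N-conditions if: (N1) every $A$-path has an even number of vertices, at least four; (N2) every inscribed clique has odd size; (N3) all inscribed cliques contain a common vertex $\xi\in V(C)$ and are pairwise disjoint apart from $\xi$; (N4) every $A\xi$-path has an even number of vertices; (N5) for distinct inscribed cliques $A,B$, every $AB$-path has an odd number of vertices. A sunoid is a multisun $G$ such that $G$ and every sub-multisun of $G$ satisfy the N-conditions.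
   Formalization: In (N5), AB-paths for distinct inscribed cliques A, B are taken with endpoints other than the common vertex ξ; read literally, (N5) contradicts (N4) whenever there are two inscribed cliques, and the theorem would fail. Graphs are finite. *)

theory Defs
  imports Main
begin

text \<open>Finite simple graphs are given by a vertex set V and an edge set E of
  two-element subsets of V.  Adjacency of u and v is {u,v} \<in> E.\<close>

definition induced_edges :: "'a set set \<Rightarrow> 'a set \<Rightarrow> 'a set set" where
  "induced_edges E S = {e \<in> E. e \<subseteq> S}"

definition diamond_free :: "'a set \<Rightarrow> 'a set set \<Rightarrow> bool" where
  "diamond_free V E \<longleftrightarrow> \<not> (\<exists>a\<in>V. \<exists>b\<in>V. \<exists>c\<in>V. \<exists>d\<in>V. distinct [a, b, c, d] \<and>
      {a, b} \<in> E \<and> {a, c} \<in> E \<and> {b, c} \<in> E \<and> {b, d} \<in> E \<and> {c, d} \<in> E \<and> {a, d} \<notin> E)"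

definition is_clique :: "'a set \<Rightarrow> 'a set set \<Rightarrow> 'a set \<Rightarrow> bool" where
  "is_clique V E Q \<longleftrightarrow> Q \<noteq> {} \<and> Q \<subseteq> V \<and> (\<forall>u\<in>Q. \<forall>v\<in>Q. u \<noteq> v \<longrightarrow> {u, v} \<in> E)"

definition max_clique :: "'a set \<Rightarrow> 'a set set \<Rightarrow> 'a set \<Rightarrow> bool" where
  "max_clique V E Q \<longleftrightarrow> is_clique V E Q \<and> (\<forall>Q'. is_clique V E Q' \<and> Q \<subseteq> Q' \<longrightarrow> Q' = Q)"

definition clique_transversal :: "'a set \<Rightarrow> 'a set set \<Rightarrow> 'a set \<Rightarrow> bool" where
  "clique_transversal V E T \<longleftrightarrow> T \<subseteq> V \<and> (\<forall>Q. max_clique V E Q \<longrightarrow> T \<inter> Q \<noteq> {})"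

definition tau_c :: "'a set \<Rightarrow> 'a set set \<Rightarrow> nat" where
  "tau_c V E = Min (card ` {T. clique_transversal V E T})"

definition clique_independent :: "'a set \<Rightarrow> 'a set set \<Rightarrow> 'a set set \<Rightarrow> bool" where
  "clique_independent V E F \<longleftrightarrow> (\<forall>Q\<in>F. max_clique V E Q) \<and> pairwise disjnt F"

definition alpha_c :: "'a set \<Rightarrow> 'a set set \<Rightarrow> nat" where
  "alpha_c V E = Max (card ` {F. clique_independent V E F})"

definition clique_perfect :: "'a set \<Rightarrow> 'a set set \<Rightarrow> bool" where
  "clique_perfect V E \<longleftrightarrow>
     (\<forall>S \<subseteq> V. tau_c S (induced_edges E S) = alpha_c S (induced_edges E S))"

definition odd_hole :: "'a set \<Rightarrow> 'a set set \<Rightarrow> bool" where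
  "odd_hole V E \<longleftrightarrow> (\<exists>c. odd (card V) \<and> card V \<ge> 5 \<and> bij_betw c {0..<card V} V \<and>
     (\<forall>i < card V. \<forall>j < card V.
        {c i, c j} \<in> E \<longleftrightarrow> (j = Suc i mod card V \<or> i = Suc j mod card V)))"

definition rim_edges :: "(nat \<Rightarrow> 'a) \<Rightarrow> nat \<Rightarrow> 'a set set" where
  "rim_edges c n = {{c i, c (Suc i mod n)} | i. i < n}"

definition multisun_rim :: "'a set \<Rightarrow> 'a set set \<Rightarrow> (nat \<Rightarrow> 'a) \<Rightarrow> bool" where
  "multisun_rim V E c \<longleftrightarrow> odd (card V) \<and> card V \<ge> 3 \<and> bij_betw c {0..<card V} V \<and>
     diamond_free V E \<and>
     {Q. max_clique V E Q \<and> card Q = 2} = rim_edges c (card V) \<and>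
     (\<forall>Q. max_clique V E Q \<and> card Q \<noteq> 2 \<longrightarrow>
        (\<forall>u\<in>Q. \<forall>v\<in>Q. u \<noteq> v \<longrightarrow> {u, v} \<notin> rim_edges c (card V)))"

definition inscribed_cliques :: "'a set \<Rightarrow> 'a set set \<Rightarrow> 'a set set" where
  "inscribed_cliques V E = {Q. max_clique V E Q \<and> card Q \<noteq> 2}"

text \<open>The subpath of the rim starting at position i and having k+1 vertices
  c i, c (i+1), ..., c (i+k) (indices mod n), with 1 \<le> k < n, whose internal
  vertices lie in no inscribed clique (of the family Ins).\<close>
definition rim_path :: "'a set \<Rightarrow> (nat \<Rightarrow> 'a) \<Rightarrow> 'a set set \<Rightarrow> nat \<Rightarrow> nat \<Rightarrow> bool" where
  "rim_path V c Ins i k \<longleftrightarrow> i < card V \<and> 0 < k \<and> k < card V \<and>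
     (\<forall>j. 0 < j \<and> j < k \<longrightarrow> c ((i + j) mod card V) \<notin> \<Union>Ins)"

definition N_conditions :: "'a set \<Rightarrow> (nat \<Rightarrow> 'a) \<Rightarrow> 'a set set \<Rightarrow> bool" where
  "N_conditions V c Ins \<longleftrightarrow>
     \<comment> \<open>N1\<close>
     (\<forall>A\<in>Ins. \<forall>i k. rim_path V c Ins i k \<and> c i \<in> A \<and> c ((i + k) mod card V) \<in> A
        \<longrightarrow> even (k + 1) \<and> k + 1 \<ge> 4) \<and>
     \<comment> \<open>N2\<close>
     (\<forall>A\<in>Ins. odd (card A)) \<and>
     (\<exists>\<xi>\<in>V.
       \<comment> \<open>N3\<close>
       (\<forall>A\<in>Ins. \<xi> \<in> A) \<and> (\<forall>A\<in>Ins. \<forall>B\<in>Ins. A \<noteq> B \<longrightarrow> A \<inter> B = {\<xi>}) \<and>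
       \<comment> \<open>N4\<close>
       (\<forall>A\<in>Ins. \<forall>i k. rim_path V c Ins i k \<and>
          ((c i \<in> A \<and> c ((i + k) mod card V) = \<xi>) \<or> (c i = \<xi> \<and> c ((i + k) mod card V) \<in> A))
          \<longrightarrow> even (k + 1))) \<and>
     \<comment> \<open>N5 (endpoints taken in A - B and B - A, i.e. distinct from the shared vertex)\<close>
     (\<forall>A\<in>Ins. \<forall>B\<in>Ins. A \<noteq> B \<longrightarrow> (\<forall>i k. rim_path V c Ins i k \<and>
          c i \<in> A - B \<and> c ((i + k) mod card V) \<in> B - A \<longrightarrow> odd (k + 1)))"

text \<open>A sunoid: a multisun such that it and every sub-multisun satisfy the N-conditions.
  Deleting the edge sets of a family D of inscribed cliques (D not all of them) yields a
  multisun with the same rim whose inscribed cliques are the remaining ones; so the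
  sub-multisuns correspond to the nonempty subfamilies of inscribed cliques kept.\<close>
definition sunoid :: "'a set \<Rightarrow> 'a set set \<Rightarrow> bool" where
  "sunoid V E \<longleftrightarrow> (\<exists>c. multisun_rim V E c \<and>
     (\<forall>Ins. Ins \<subseteq> inscribed_cliques V E \<and> (Ins \<noteq> {} \<or> Ins = inscribed_cliques V E)
        \<longrightarrow> N_conditions V c Ins))"

end

theory Submission
  imports Defs
begin

text \<open>In a diamond-free graph two maximal cliques share at most one vertex.  If the clique hypergraph of
  every induced subgraph is balanced, Koenig's theorem for balanced hypergraphs gives equality of the two
  parameters.  Otherwise take an induced subgraph with fewest vertices whose clique hypergraph
  contains an odd cycle of cliques each meeting the cycle in exactly two vertices.  Minimality forces
  the vertices of this cycle to be the whole subgraph, so the cycle is a rim, and rerouting arcs of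
  the rim through inscribed cliques would produce a shorter odd cycle unless the N-conditions hold
  for every family of inscribed cliques.  Conversely, an odd rim has no clique-transversal with at most
  half of its vertices and no clique-independent set with more than half as many members as vertices.\<close>

text \<open>Diamond-freeness enters in two ways. If a maximal clique meets a vertex subset in
  exactly two vertices, these two form a maximal clique of the subgraph induced there, so an odd
  cycle of cliques survives restriction to its own vertices. Moreover linearity keeps consecutive
  rim vertices out of a common inscribed clique. An arc closed by one inscribed clique controls the
  parities inside that clique, and an arc closed by two cliques through a common vertex controls
  those between them. The obstacle is that a common vertex must exist at all: against two disjoint
  inscribed cliques a shortcut needs two vertex-disjoint arcs, each leading from one clique to the
  other, of opposite parity. Finding them is a parity count around the odd rim. Every rerouting
  argument involves at most three inscribed cliques and ignores the others, so it covers all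
  sub-multisuns simultaneously; a minimal rim with no inscribed clique fits \<open>sunoid\<close>
  through the empty family.\<close>

section \<open>Bicolouring balanced hypergraphs\<close>

text \<open>The forbidden pattern is the incidence matrix of an odd cycle. Columns are indices
  rather than sets, so that repeated edges are allowed when matchings are superposed. Distinctness
  of the \<open>v t\<close> and of the \<open>i t\<close> is forced by the pattern because
  \<open>m\<close> is at least 3.\<close>

definition balanced :: "'v set \<Rightarrow> 'i set \<Rightarrow> ('v \<Rightarrow> 'i \<Rightarrow> bool) \<Rightarrow> bool" where
  "balanced V I R \<longleftrightarrow> \<not> (\<exists>m v i. odd m \<and> 3 \<le> m \<and> (\<forall>t<m. v t \<in> V \<and> i t \<in> I) \<and>
     (\<forall>s<m. \<forall>t<m. R (v s) (i t) \<longleftrightarrow> t = s \<or> t = Suc s mod m))"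

lemma balancedD:
  assumes "balanced V I R" "odd m" "3 \<le> m" "\<And>t. t < m \<Longrightarrow> v t \<in> V" "\<And>t. t < m \<Longrightarrow> i t \<in> I"
    "\<And>s t. s < m \<Longrightarrow> t < m \<Longrightarrow> R (v s) (i t) \<longleftrightarrow> t = s \<or> t = Suc s mod m"
  shows False
proof -
  have "\<exists>m v i. odd m \<and> 3 \<le> m \<and> (\<forall>t<m. v t \<in> V \<and> i t \<in> I) \<and>
     (\<forall>s<m. \<forall>t<m. R (v s) (i t) \<longleftrightarrow> t = s \<or> t = Suc s mod m)"
    by (rule exI[of _ m], rule exI[of _ v], rule exI[of _ i]) (use assms(2-) in auto)
  with assms(1) show False
    unfolding balanced_def by (rule notE)
qed

lemma balanced_subset:
  assumes "balanced V I R" "J \<subseteq> I"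
  shows "balanced V J R"
  unfolding balanced_def
proof (rule notI, elim exE conjE)
  fix m v i
  assume *: "odd m" "3 \<le> m" "\<forall>t<m. v t \<in> V \<and> i t \<in> J"
    "\<forall>s<m. \<forall>t<m. R (v s) (i t) \<longleftrightarrow> t = s \<or> t = Suc s mod m"
  show False
    by (rule balancedD[OF assms(1) *(1,2), of v i]) (use * assms(2) in auto)
qed

text \<open>A repeated entry cuts a closed walk into two shorter closed walks whose lengths add up
  to the old one, so one of them is odd. Irreflexivity rules out length 1.\<close>

lemma odd_closed_walk_imp_odd_cycle:
  assumes "\<And>x. \<not> adj x x"
    and "odd (length ws)" "successively adj ws" "adj (last ws) (hd ws)"
  obtains us where "set us \<subseteq> set ws" "odd (length us)" "3 \<le> length us" "distinct us"
    "successively adj us" "adj (last us) (hd us)"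
  using assms(2-)
proof (induction "length ws" arbitrary: ws thesis rule: less_induct)
  case less
  show ?case
  proof (cases "distinct ws")
    case True
    have "length ws \<noteq> 1"
      using less.prems(4) assms(1) by (auto simp: length_Suc_conv)
    then have "3 \<le> length ws"
      using less.prems(2) by presburger
    with True less.prems show ?thesis by blast
  next
    case False
    then obtain xs ys zs y where ws: "ws = xs @ [y] @ ys @ [y] @ zs"
      using not_distinct_decomp by blast
    have s: "successively adj (y # ys)" "adj (last (y # ys)) y"
      "successively adj (xs @ y # zs)" "adj (last (xs @ y # zs)) (hd (xs @ y # zs))"
      using less.prems(3,4) unfolding ws
      by (auto simp: successively_append_iff successively_Cons hd_append split: if_splits)
    have "odd (length (y # ys)) \<or> odd (length (xs @ y # zs))"
      using less.prems(2) unfolding ws by auto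
    then consider "odd (length (y # ys))" | "odd (length (xs @ y # zs))" by blast
    then show ?thesis
    proof cases
      case 1
      obtain us where "set us \<subseteq> set (y # ys)" "odd (length us)" "3 \<le> length us" "distinct us"
        "successively adj us" "adj (last us) (hd us)"
        by (rule less.hyps[of "y # ys"]) (use 1 s ws in auto)
      then show ?thesis using less.prems(1)[of us] ws by auto
    next
      case 2
      obtain us where "set us \<subseteq> set (xs @ y # zs)" "odd (length us)" "3 \<le> length us" "distinct us"
        "successively adj us" "adj (last us) (hd us)"
        by (rule less.hyps[of "xs @ y # zs"]) (use 2 s ws in auto)
      then show ?thesis using less.prems(1)[of us] ws by auto
    qed
  qed
qed

lemma cyclic_nth:
  assumes "successively P ws" "P (last ws) (hd ws)" "t < length ws"
  shows "P (ws ! t) (ws ! (Suc t mod length ws))"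
proof (cases "Suc t < length ws")
  case True
  then show ?thesis using successively_nth[OF assms(1)] by simp
next
  case False
  then have *: "length ws = Suc t" using assms(3) by simp
  then have "ws \<noteq> []" by auto
  then show ?thesis using assms(2) by (simp add: hd_conv_nth last_conv_nth *)
qed

text \<open>The graph \<open>adj\<close> joins two columns that form the full support of some row.
  An odd cycle in it, with one such row per edge, is the forbidden pattern; so balancedness makes
  this graph bipartite.\<close>

lemma balanced_imp_no_odd_closed_walk:
  assumes "balanced V I R"
    and adj: "adj = (\<lambda>i k. i \<noteq> k \<and> (\<exists>v\<in>V. {x \<in> I. R v x} = {i, k}))"
    and "odd (length ws)" "successively adj ws" "adj (last ws) (hd ws)"
  shows False
proof -
  have "\<not> adj x x" for x by (simp add: adj)
  then obtain us where us: "odd (length us)" "3 \<le> length us" "distinct us"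
    "successively adj us" "adj (last us) (hd us)"
    using odd_closed_walk_imp_odd_cycle[of adj ws] assms(3-5) by metis
  let ?m = "length us"
  have "\<exists>v\<in>V. {x \<in> I. R v x} = {us ! t, us ! (Suc t mod ?m)}" if "t < ?m" for t
    using cyclic_nth[OF us(4,5) that] by (simp add: adj)
  then obtain v where v: "\<And>t. t < ?m \<Longrightarrow> v t \<in> V"
    "\<And>t. t < ?m \<Longrightarrow> {x \<in> I. R (v t) x} = {us ! t, us ! (Suc t mod ?m)}"
    by metis
  have I: "us ! t \<in> I" if "t < ?m" for t
    using v(2)[OF that] by blast
  have "R (v s) (us ! t) \<longleftrightarrow> t = s \<or> t = Suc s mod ?m" if "s < ?m" "t < ?m" for s t
  proof -
    have "R (v s) (us ! t) \<longleftrightarrow> us ! t \<in> {x \<in> I. R (v s) x}"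
      using I that by blast
    also have "\<dots> \<longleftrightarrow> us ! t = us ! s \<or> us ! t = us ! (Suc s mod ?m)"
      using v(2)[OF that(1)] by auto
    also have "\<dots> \<longleftrightarrow> t = s \<or> t = Suc s mod ?m"
    proof -
      have "Suc s mod ?m < ?m" using that(1) mod_less_divisor[of ?m "Suc s"] by linarith
      then show ?thesis
        using that by (simp add: nth_eq_iff_index_eq[OF us(3)])
    qed
    finally show ?thesis .
  qed
  then show False
    using balancedD[OF assms(1) us(1,2), of v "(!) us"] v(1) I by blast
qed

text \<open>One walk followed by the reverse of the other is a closed walk of length
  \<open>s + t\<close>.\<close>

lemma bipartite_walk_parity:
  assumes "\<And>x y. adj x y \<Longrightarrow> adj y x"
    and bip: "\<And>ws. odd (length ws) \<Longrightarrow> successively adj ws \<Longrightarrow> adj (last ws) (hd ws) \<Longrightarrow> False"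
    and "(adj ^^ s) x y" "(adj ^^ t) x y"
  shows "even s \<longleftrightarrow> even t"
proof -
  have rev: "(adj ^^ t) y x" if "(adj ^^ t) x y" for t x y
    using that
  proof (induction t arbitrary: y)
    case (Suc t)
    then obtain z where "(adj ^^ t) x z" "adj z y" by auto
    then show ?case
      using Suc.IH assms(1) by (metis relpowp_Suc_I2)
  qed auto
  have "(adj ^^ (s + t)) x x"
    using assms(3) rev[OF assms(4)] by (auto simp: relpowp_add)
  then obtain f where f: "f 0 = x" "f (s + t) = x" "\<And>i. i < s + t \<Longrightarrow> adj (f i) (f (Suc i))"
    by (metis relpowp_fun_conv)
  have False if odd: "odd (s + t)"
  proof (rule bip[of "map f [0..<s + t]"])
    obtain k where k: "s + t = Suc k"
      using odd by (cases "s + t") auto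
    have "hd (map f [0..<Suc k]) = f 0"
      by (simp add: upt_conv_Cons del: upt_Suc)
    then show "adj (last (map f [0..<s + t])) (hd (map f [0..<s + t]))"
      using f(3)[of k] f(1,2) unfolding k by simp
  qed (use odd f(3) in \<open>auto simp: successively_conv_nth\<close>)
  then show ?thesis by auto
qed

text \<open>Induction removes a point farthest from some root in its component of the graph formed by
  the rows with two entries.  The rest of the component stays connected, so the two-entry rows
  force the colours there, and the removed point can be coloured opposite to all its neighbours.\<close>

theorem balanced_bicolouring:
  assumes "finite I" "balanced V I R"
  shows "\<exists>col :: 'i \<Rightarrow> bool. \<forall>v\<in>V. 2 \<le> card {i \<in> I. R v i} \<longrightarrow>
    (\<exists>i\<in>I. \<exists>k\<in>I. R v i \<and> R v k \<and> col i \<and> \<not> col k)"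
  using assms
proof (induction "card I" arbitrary: I rule: less_induct)
  case less
  show ?case
  proof (cases "I = {}")
    case True
    then show ?thesis by simp
  next
    case False
    then obtain r where r: "r \<in> I" by blast
    define adj where "adj = (\<lambda>i k. i \<noteq> k \<and> (\<exists>v\<in>V. {x \<in> I. R v x} = {i, k}))"
    have sym: "adj y x" if "adj x y" for x y
      using that unfolding adj_def by (metis insert_commute)
    have adjI: "x \<in> I" "y \<in> I" if "adj x y" for x y
      using that unfolding adj_def by blast+
    define C where "C = {x. adj\<^sup>*\<^sup>* r x}"
    have C: "C \<subseteq> I"
    proof
      fix x assume "x \<in> C"
      then have "adj\<^sup>*\<^sup>* r x" by (simp add: C_def)
      then show "x \<in> I" by (induction) (use r adjI in auto)
    qed
    then have "finite C" using less.prems(1) finite_subset by blast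
    define d where "d x = (LEAST t. (adj ^^ t) r x)" for x
    have dwalk: "(adj ^^ d x) r x" if "x \<in> C" for x
      using that unfolding d_def C_def by (metis LeastI_ex mem_Collect_eq rtranclp_imp_relpowp)
    have "r \<in> C" by (simp add: C_def)
    have "Max (d ` C) \<in> d ` C"
      using \<open>finite C\<close> \<open>r \<in> C\<close> by (intro Max_in) auto
    then obtain j where j: "j \<in> C" "Max (d ` C) = d j" by blast
    have d_le: "d x \<le> d j" if "x \<in> C" for x
      using \<open>finite C\<close> that by (simp flip: j(2))
    have par: "odd (d y) \<longleftrightarrow> even (d x)" if "adj x y" "x \<in> C" for x y
    proof -
      have y: "y \<in> C" using that unfolding C_def by auto
      have "(adj ^^ Suc (d x)) r y" using dwalk[OF that(2)] that(1) by auto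
      then have "even (Suc (d x)) \<longleftrightarrow> even (d y)"
        using bipartite_walk_parity[of adj "Suc (d x)" r y "d y"] sym
          balanced_imp_no_odd_closed_walk[OF less.prems(2) adj_def] dwalk[OF y] by metis
      then show ?thesis by auto
    qed
    define J where "J = I - {j}"
    have "j \<in> I" using C j(1) by blast
    have "card J < card I"
      unfolding J_def using less.prems(1) \<open>j \<in> I\<close> by (rule card_Diff1_less)
    moreover have "finite J" "balanced V J R"
      using less.prems balanced_subset[of V I R J] unfolding J_def by auto
    ultimately obtain col :: "'i \<Rightarrow> bool" where col: "\<And>v. v \<in> V \<Longrightarrow> 2 \<le> card {i \<in> J. R v i} \<Longrightarrow>
      \<exists>i\<in>J. \<exists>k\<in>J. R v i \<and> R v k \<and> col i \<and> \<not> col k"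
      using less.hyps by blast
    have col_adj: "col x \<noteq> col y" if xy: "adj x y" "x \<noteq> j" "y \<noteq> j" for x y
    proof -
      obtain v where v: "v \<in> V" "{i \<in> I. R v i} = {x, y}" "x \<noteq> y"
        using xy(1) unfolding adj_def by blast
      then have "{i \<in> J. R v i} = {x, y}" using xy(2,3) unfolding J_def by blast
      then obtain i k where "i \<in> {x, y}" "k \<in> {x, y}" "col i" "\<not> col k"
        using col[OF v(1)] v(3) by auto
      then show ?thesis by auto
    qed
    have forced: "col x \<longleftrightarrow> (col r \<noteq> odd (d x))" if "x \<in> C" "x \<noteq> j" for x
      using that
    proof (induction "d x" arbitrary: x)
      case 0
      then have "x = r" using dwalk[of x] by simp
      then show ?case using 0 by simp
    next
      case (Suc t)
      then obtain p where p: "(adj ^^ t) r p" "adj p x"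
        using dwalk[of x] by (metis relpowp_Suc_E)
      have pC: "p \<in> C" using p(1) by (simp add: C_def relpowp_imp_rtranclp)
      have "d p \<le> t" using p(1) unfolding d_def by (rule Least_le)
      moreover have "d x \<le> Suc (d p)"
        unfolding d_def[of x] by (rule Least_le) (use dwalk[OF pC] p(2) in auto)
      ultimately have t: "t = d p" using Suc.hyps(2) by simp
      \<comment> \<open>\<open>p\<close> precedes \<open>x\<close> on a shortest walk and is
        strictly closer to \<open>r\<close>, whereas \<open>j\<close> is at maximal distance; so
        shortest walks reach \<open>x\<close> without passing \<open>j\<close>.\<close>
      have pj: "p \<noteq> j" using d_le[OF Suc.prems(1)] t Suc.hyps(2) by auto
      show ?case
        using Suc.hyps(1)[OF t pC pj] col_adj[OF p(2) pj Suc.prems(2)] par[OF p(2) pC] by blast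
    qed
    define col' where "col' = col(j := (col r \<noteq> odd (d j)))"
    have "\<exists>i\<in>I. \<exists>k\<in>I. R v i \<and> R v k \<and> col' i \<and> \<not> col' k"
      if v: "v \<in> V" "2 \<le> card {i \<in> I. R v i}" for v
    proof (cases "2 \<le> card {i \<in> J. R v i}")
      case True
      then show ?thesis using col[OF v(1) True] unfolding J_def col'_def by auto
    next
      \<comment> \<open>Removing \<open>j\<close> left fewer than two entries, so the row is exactly
        \<open>{j, k}\<close> with \<open>k\<close> a neighbour of \<open>j\<close> whose colour is
        forced.\<close>
      case False
      have fin: "finite {i \<in> I. R v i}" using less.prems(1) by simp
      have J: "{i \<in> J. R v i} = {i \<in> I. R v i} - {j}" unfolding J_def by auto
      have "card {i \<in> I. R v i} = 2" and "R v j"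
        using False v(2) fin card_Diff_singleton[of j "{i \<in> I. R v i}"] \<open>j \<in> I\<close>
        unfolding J by (auto simp: card_Diff_singleton_if split: if_splits)
      then obtain x y where xy: "{i \<in> I. R v i} = {x, y}" "x \<noteq> y"
        by (auto simp: card_2_iff)
      then have "j \<in> {x, y}"
        using \<open>j \<in> I\<close> \<open>R v j\<close> by blast
      then obtain k where k: "{i \<in> I. R v i} = {j, k}" "k \<noteq> j"
        using xy by blast
      then have "adj j k" unfolding adj_def using v(1) by blast
      then have "k \<in> C" using j(1) unfolding C_def by auto
      then have "col' k \<noteq> col' j"
        using forced[of k] par[OF \<open>adj j k\<close> j(1)] k(2) unfolding col'_def by auto
      then show ?thesis using k(1) by blast
    qed
    then show ?thesis by blast
  qed
qed

section \<open>Koenig's theorem for balanced hypergraphs\<close>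

text \<open>Among all colourings one maximises the total number of colours seen by the vertices.  If some
  vertex sees colour p twice, it misses some q, and recolouring the edges of colours p and q by a
  bicolouring increases the total.\<close>

theorem balanced_edge_colouring:
  fixes R :: "'v \<Rightarrow> 'i \<Rightarrow> bool"
  assumes "finite V" "finite I" "balanced V I R" "0 < D"
    and deg: "\<And>v. v \<in> V \<Longrightarrow> card {i \<in> I. R v i} \<le> D"
  shows "\<exists>col :: 'i \<Rightarrow> nat. (\<forall>i. col i < D) \<and> (\<forall>v\<in>V. inj_on col {i \<in> I. R v i})"
proof -
  define N where "N v = {i \<in> I. R v i}" for v
  have finN: "finite (N v)" for v using assms(2) by (simp add: N_def)
  define pot where "pot col = (\<Sum>v\<in>V. card (col ` N v))" for col :: "'i \<Rightarrow> nat"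
  have "pot col \<le> (\<Sum>v\<in>V. card (N v))" for col
    unfolding pot_def by (intro sum_mono card_image_le finN)
  then have "\<forall>col. (\<forall>i. col i < D) \<longrightarrow> pot col < Suc (\<Sum>v\<in>V. card (N v))"
    by (simp add: less_Suc_eq_le)
  moreover have "\<forall>i. (\<lambda>_::'i. 0) i < D" using assms(4) by simp
  ultimately have "\<exists>col. (\<forall>i. col i < D) \<and> (\<forall>col'. (\<forall>i. col' i < D) \<longrightarrow> pot col' \<le> pot col)"
    by (intro ex_has_greatest_nat)
  then obtain col where col: "\<forall>i. col i < D"
    and mx: "\<And>col'. \<forall>i. col' i < D \<Longrightarrow> pot col' \<le> pot col"
    by blast
  have "inj_on col (N v)" if v: "v \<in> V" for v
  proof (rule ccontr)
    assume ninj: "\<not> inj_on col (N v)"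
    then obtain i k where ik: "i \<in> N v" "k \<in> N v" "i \<noteq> k" "col i = col k"
      by (auto simp: inj_on_def)
    define p where "p = col i"
    have "card (col ` N v) < card (N v)"
      using ninj finN[of v] by (meson card_image_le eq_card_imp_inj_on le_neq_implies_less)
    then have "card (col ` N v) < card {..<D}"
      using deg[OF v] by (simp add: N_def)
    then have "\<not> {..<D} \<subseteq> col ` N v"
      using card_mono[OF finite_imageI[OF finN], of "{..<D}"] by (metis not_le)
    then obtain q where q: "q < D" "q \<notin> col ` N v" by blast
    have "p \<noteq> q" using q(2) ik(1) unfolding p_def by blast
    define J where "J = {i \<in> I. col i = p \<or> col i = q}"
    have "finite J" using assms(2) by (simp add: J_def)
    moreover have "balanced V J R"
      by (rule balanced_subset[OF assms(3)]) (auto simp: J_def)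
    ultimately obtain f :: "'i \<Rightarrow> bool" where f: "\<forall>u\<in>V. 2 \<le> card {i \<in> J. R u i} \<longrightarrow>
      (\<exists>i\<in>J. \<exists>k\<in>J. R u i \<and> R u k \<and> f i \<and> \<not> f k)"
      using balanced_bicolouring[of J V R] by blast
    define col' where "col' x = (if x \<in> J then if f x then p else q else col x)" for x
    have col': "\<forall>x. col' x < D" using col q(1) by (simp add: col'_def p_def)
    have both: "{p, q} \<subseteq> col' ` (N u \<inter> J)" if u: "u \<in> V" and xy: "x \<in> N u \<inter> J" "y \<in> N u \<inter> J" "x \<noteq> y" for u x y
    proof -
      have "card {x, y} \<le> card {i \<in> J. R u i}"
        using xy \<open>finite J\<close> by (intro card_mono) (auto simp: N_def)
      then have "2 \<le> card {i \<in> J. R u i}" using xy(3) by simp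
      then obtain a b where "a \<in> J" "b \<in> J" "R u a" "R u b" "f a" "\<not> f b"
        using f u by blast
      then have "a \<in> N u \<inter> J" "b \<in> N u \<inter> J" "col' a = p" "col' b = q"
        by (auto simp: N_def J_def col'_def)
      then show ?thesis by blast
    qed
    have split: "card (g ` N u) = card (col ` (N u - J)) + card (g ` (N u \<inter> J))"
      if "g = col \<or> g = col'" for g u
    proof -
      have "g ` N u = col ` (N u - J) \<union> g ` (N u \<inter> J)"
        using that by (force simp: col'_def)
      moreover have "col ` (N u - J) \<inter> g ` (N u \<inter> J) = {}"
        using that by (auto simp: N_def J_def col'_def split: if_splits)
      ultimately show ?thesis using finN by (simp add: card_Un_disjoint)
    qed
    have pq: "g ` (N u \<inter> J) \<subseteq> {p, q}" if "g = col \<or> g = col'" for g u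
      using that by (auto simp: J_def col'_def)
    have full: "card (col' ` (N u \<inter> J)) = 2"
      if u: "u \<in> V" and xy: "x \<in> N u \<inter> J" "y \<in> N u \<inter> J" "x \<noteq> y" for u x y
    proof -
      have "col' ` (N u \<inter> J) = {p, q}"
        using pq[of col' u] both[OF u xy] by (intro subset_antisym) simp_all
      then show ?thesis using \<open>p \<noteq> q\<close> by simp
    qed
    \<comment> \<open>A vertex with two or more edges in \<open>J\<close> sees both \<open>p\<close>
      and \<open>q\<close> after recolouring; one with at most one such edge keeps its count. At
      \<open>v\<close> the colour \<open>p\<close> was repeated and \<open>q\<close> missing, so
      there the gain is strict.\<close>
    have le: "card (col ` (N u \<inter> J)) \<le> card (col' ` (N u \<inter> J))" if u: "u \<in> V" for u
    proof (cases "\<exists>x y. x \<in> N u \<inter> J \<and> y \<in> N u \<inter> J \<and> x \<noteq> y")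
      case True
      then obtain x y where "x \<in> N u \<inter> J" "y \<in> N u \<inter> J" "x \<noteq> y" by blast
      then have "card (col' ` (N u \<inter> J)) = 2" by (rule full[OF u])
      moreover have "card (col ` (N u \<inter> J)) \<le> 2"
        using card_mono[OF _ pq[of col u]] \<open>p \<noteq> q\<close> by simp
      ultimately show ?thesis by simp
    next
      case False
      then have "N u \<inter> J = {} \<or> (\<exists>x. N u \<inter> J = {x})" by blast
      then show ?thesis by auto
    qed
    have "i \<in> N v \<inter> J" "k \<in> N v \<inter> J"
      using ik by (auto simp: N_def J_def p_def)
    moreover have "col ` (N v \<inter> J) = {p}"
      using calculation q(2) by (auto simp: J_def p_def)
    moreover have "card (col' ` (N v \<inter> J)) = 2"
      using calculation(1,2) by (rule full[OF v _ _ ik(3)])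
    ultimately have "card (col ` (N v \<inter> J)) < card (col' ` (N v \<inter> J))"
      by simp
    then have "card (col ` N v) < card (col' ` N v)"
      by (simp add: split)
    moreover have "\<forall>u\<in>V. card (col ` N u) \<le> card (col' ` N u)"
      using le by (simp add: split)
    ultimately have "pot col < pot col'"
      unfolding pot_def using v assms(1) by (intro sum_strict_mono_ex1) blast+
    then show False using mx[OF col'] by simp
  qed
  then show ?thesis using col by (auto simp: N_def)
qed

text \<open>Otherwise each vertex v is missed by some maximum matching M v.  The multiset sum of all M v has
  maximum degree below the number of vertices, so by the edge colouring theorem it splits into too few
  matchings.\<close>

lemma vertex_in_all_maximum_matchings:
  fixes M :: "'a set set"
  assumes "finite V" "finite M" "\<And>Q. Q \<in> M \<Longrightarrow> Q \<subseteq> V \<and> Q \<noteq> {}"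
    and "balanced V M (\<in>)"
    and F: "F \<subseteq> M" "pairwise disjnt F" "F \<noteq> {}"
    and mx: "\<And>F'. F' \<subseteq> M \<Longrightarrow> pairwise disjnt F' \<Longrightarrow> card F' \<le> card F"
  shows "\<exists>v\<in>V. \<forall>F'. F' \<subseteq> M \<and> pairwise disjnt F' \<and> card F' = card F \<longrightarrow> v \<in> \<Union>F'"
proof (rule ccontr)
  assume "\<not> ?thesis"
  then obtain m where m: "\<And>v. v \<in> V \<Longrightarrow> m v \<subseteq> M" "\<And>v. v \<in> V \<Longrightarrow> pairwise disjnt (m v)"
    "\<And>v. v \<in> V \<Longrightarrow> card (m v) = card F" "\<And>v. v \<in> V \<Longrightarrow> v \<notin> \<Union>(m v)"
    by metis
  have "finite F" using F(1) assms(2) finite_subset by blast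
  then have pos: "0 < card F" using F(3) by (simp add: card_gt_0_iff)
  have finm: "finite (m v)" if "v \<in> V" for v using m(1)[OF that] assms(2) finite_subset by blast
  \<comment> \<open>The first component records which matching an edge comes from, so an edge chosen
    by several matchings is counted with multiplicity.\<close>
  define I where "I = Sigma V m"
  have "finite I" using assms(1) finm by (auto simp: I_def)
  have cardI: "card I = card V * card F"
    unfolding I_def using m(3) assms(1) finm by (simp add: card_SigmaI)
  define R where "R u i \<longleftrightarrow> u \<in> snd i" for u :: 'a and i :: "'a \<times> 'a set"
  have "balanced V I R"
    unfolding balanced_def
  proof (rule notI, elim exE conjE)
    fix k v i
    assume *: "odd k" "3 \<le> k" "\<forall>t<k. v t \<in> V \<and> i t \<in> I"
      "\<forall>s<k. \<forall>t<k. R (v s) (i t) \<longleftrightarrow> t = s \<or> t = Suc s mod k"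
    show False
    proof (rule balancedD[OF assms(4) *(1,2), of v "\<lambda>t. snd (i t)"])
      show "v t \<in> V" "snd (i t) \<in> M" if "t < k" for t
        using *(3) that m(1) by (fastforce simp: I_def)+
      show "v s \<in> snd (i t) \<longleftrightarrow> t = s \<or> t = Suc s mod k" if "s < k" "t < k" for s t
        using *(4) that by (simp add: R_def)
    qed
  qed
  \<comment> \<open>A vertex \<open>u\<close> is covered at most once by each \<open>m v\<close> and
    never by \<open>m u\<close>.\<close>
  define D where "D = card V - 1"
  have deg: "card {i \<in> I. R u i} \<le> D" if u: "u \<in> V" for u
  proof -
    have "inj_on fst {i \<in> I. R u i}"
    proof (rule inj_onI)
      fix x y assume xy: "x \<in> {i \<in> I. R u i}" "y \<in> {i \<in> I. R u i}" "fst x = fst y"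
      then have "fst x \<in> V" "snd x \<in> m (fst x)" "snd y \<in> m (fst x)" "u \<in> snd x" "u \<in> snd y"
        by (auto simp: I_def R_def)
      then have "snd x = snd y"
        using m(2)[of "fst x"] unfolding pairwise_def disjnt_def by blast
      then show "x = y" using xy(3) by (simp add: prod_eq_iff)
    qed
    moreover have "fst ` {i \<in> I. R u i} \<subseteq> V - {u}"
      using m(4) by (force simp: I_def R_def)
    ultimately have "card {i \<in> I. R u i} \<le> card (V - {u})"
      using assms(1) by (intro card_inj_on_le) auto
    then show ?thesis using u by (simp add: D_def)
  qed
  have "0 < D"
  proof -
    obtain Q where "Q \<in> F" using F(3) by blast
    then obtain u where u: "u \<in> V" using assms(3) F(1) by blast
    then have "m u \<noteq> {}" using m(3)[OF u] pos by auto
    then obtain Q' where Q': "Q' \<in> m u" by blast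
    then obtain u' where u': "u' \<in> Q'" "u' \<in> V" using m(1)[OF u] assms(3)[of Q'] by blast
    then have "(u, Q') \<in> {i \<in> I. R u' i}" using Q' u by (simp add: I_def R_def)
    then have "card {i \<in> I. R u' i} > 0" using \<open>finite I\<close> by (auto simp: card_gt_0_iff)
    then show ?thesis using deg[OF u'(2)] by simp
  qed
  obtain col :: "'a \<times> 'a set \<Rightarrow> nat" where col: "\<And>i. col i < D" "\<And>v. v \<in> V \<Longrightarrow> inj_on col {i \<in> I. R v i}"
    using balanced_edge_colouring[OF assms(1) \<open>finite I\<close> \<open>balanced V I R\<close> \<open>0 < D\<close> deg] by blast
  \<comment> \<open>Edges of one colour are pairwise disjoint and nonempty, so no edge occurs twice
    in a class and each class is a matching in \<open>M\<close>. The \<open>card V * card F\<close>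
    pairs cannot fit into \<open>card V - 1\<close> such classes.\<close>
  have class_le: "card {i \<in> I. col i = c} \<le> card F" for c
  proof -
    have inj: "x = y" if "x \<in> I" "y \<in> I" "col x = c" "col y = c" "u \<in> snd x" "u \<in> snd y" for x y u
    proof -
      have "u \<in> V" using that(1,5) m(1) assms(3) by (force simp: I_def)
      then show ?thesis using col(2) that unfolding inj_on_def R_def by blast
    qed
    have ne: "snd x \<noteq> {} \<and> snd x \<in> M" if "x \<in> I" for x
      using that m(1) assms(3) by (force simp: I_def)
    have "inj_on snd {i \<in> I. col i = c}"
      by (rule inj_onI) (use inj ne in blast)
    moreover have "card (snd ` {i \<in> I. col i = c}) \<le> card F"
    proof (rule mx)
      show "snd ` {i \<in> I. col i = c} \<subseteq> M" using ne by blast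
      show "pairwise disjnt (snd ` {i \<in> I. col i = c})"
      proof (rule pairwiseI)
        fix P Q assume PQ: "P \<in> snd ` {i \<in> I. col i = c}" "Q \<in> snd ` {i \<in> I. col i = c}" "P \<noteq> Q"
        then obtain x y where xy: "x \<in> I" "col x = c" "P = snd x" "y \<in> I" "col y = c" "Q = snd y"
          by blast
        show "disjnt P Q"
          unfolding disjnt_iff using inj[OF xy(1,4,2,5)] PQ(3) xy(3,6) by blast
      qed
    qed
    ultimately show ?thesis by (simp add: card_image)
  qed
  have "I = (\<Union>c<D. {i \<in> I. col i = c})" using col(1) by auto
  then have "card I \<le> (\<Sum>c<D. card {i \<in> I. col i = c})"
    using card_UN_le[of "{..<D}" "\<lambda>c. {i \<in> I. col i = c}"] by simp
  also have "\<dots> \<le> D * card F"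
    using sum_bounded_above[of "{..<D}" "\<lambda>c. card {i \<in> I. col i = c}" "card F"] class_le by simp
  finally have "card V \<le> D" using cardI pos by simp
  then show False using \<open>0 < D\<close> by (simp add: D_def)
qed

text \<open>Some vertex \<open>v\<close> lies in every maximum matching, so deleting the edges
  through \<open>v\<close> lowers the matching number. The transversal that induction gives for the
  remaining edges is then small enough to leave room for \<open>v\<close>.\<close>

theorem balanced_koenig:
  fixes M :: "'a set set"
  assumes "finite V" "finite M" "\<And>Q. Q \<in> M \<Longrightarrow> Q \<subseteq> V \<and> Q \<noteq> {}" "balanced V M (\<in>)"
  shows "\<exists>T F. T \<subseteq> V \<and> (\<forall>Q\<in>M. T \<inter> Q \<noteq> {}) \<and> F \<subseteq> M \<and> pairwise disjnt F \<and> card T \<le> card F"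
  using assms(2-)
proof (induction "card M" arbitrary: M rule: less_induct)
  case less
  show ?case
  proof (cases "M = {}")
    case True
    then show ?thesis by (intro exI[of _ "{}"]) auto
  next
    case False
    then obtain Q0 where "Q0 \<in> M" by blast
    have "\<exists>F. (F \<subseteq> M \<and> pairwise disjnt F) \<and> (\<forall>F'. F' \<subseteq> M \<and> pairwise disjnt F' \<longrightarrow> card F' \<le> card F)"
      by (rule ex_has_greatest_nat[of _ "{Q0}" _ "Suc (card M)"])
        (use \<open>Q0 \<in> M\<close> less.prems(1) in \<open>auto simp: pairwise_def card_mono less_Suc_eq_le\<close>)
    then obtain F where F: "F \<subseteq> M" "pairwise disjnt F"
      and mx: "\<And>F'. F' \<subseteq> M \<Longrightarrow> pairwise disjnt F' \<Longrightarrow> card F' \<le> card F"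
      by metis
    have "card {Q0} \<le> card F" by (rule mx) (use \<open>Q0 \<in> M\<close> in \<open>auto simp: pairwise_def\<close>)
    then have "F \<noteq> {}" by auto
    then obtain v where v: "v \<in> V"
      "\<And>F'. F' \<subseteq> M \<Longrightarrow> pairwise disjnt F' \<Longrightarrow> card F' = card F \<Longrightarrow> v \<in> \<Union>F'"
      using vertex_in_all_maximum_matchings[OF assms(1) less.prems F _ mx] by blast
    define M' where "M' = {Q \<in> M. v \<notin> Q}"
    obtain Q where "Q \<in> F" "v \<in> Q" using v(2)[OF F] by blast
    then have "M' \<subset> M" using F(1) unfolding M'_def by blast
    then have less_M: "card M' < card M" using less.prems(1) by (rule psubset_card_mono[rotated])
    have fin: "finite M'"
      using \<open>M' \<subset> M\<close> less.prems(1) by (auto intro: finite_subset)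
    have bal: "balanced V M' (\<in>)"
      using \<open>M' \<subset> M\<close> less.prems(3) by (auto intro: balanced_subset)
    have "Q \<subseteq> V \<and> Q \<noteq> {}" if "Q \<in> M'" for Q
      using \<open>M' \<subset> M\<close> less.prems(2) that by blast
    from less.hyps[OF less_M fin this bal] obtain T' F' where T': "T' \<subseteq> V" "\<forall>Q\<in>M'. T' \<inter> Q \<noteq> {}"
      and F': "F' \<subseteq> M'" "pairwise disjnt F'" "card T' \<le> card F'"
      by blast
    have "F' \<subseteq> M" using F'(1) unfolding M'_def by blast
    moreover have "v \<notin> \<Union>F'" using F'(1) unfolding M'_def by blast
    ultimately have "card F' < card F"
      using mx[of F'] v(2)[of F'] F'(2) by fastforce
    moreover have "card (insert v T') \<le> Suc (card T')" by (rule card_insert_le_m1) auto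
    ultimately have "card (insert v T') \<le> card F" using F'(3) by simp
    moreover have "\<forall>Q\<in>M. insert v T' \<inter> Q \<noteq> {}" using T'(2) unfolding M'_def by blast
    moreover have "insert v T' \<subseteq> V" using T'(1) v(1) by blast
    ultimately show ?thesis using F by (intro exI[of _ "insert v T'"] exI[of _ F]) simp
  qed
qed

section \<open>Cyclic sequences and parity\<close>

lemma add_mod_inj:
  fixes x s t n :: nat
  assumes "(x + s) mod n = (x + t) mod n" "s < n" "t < n"
  shows "s = t"
proof -
  have *: "a = b" if "(x + a) mod n = (x + b) mod n" "a < n" "b \<le> a" for a b
  proof -
    have "n dvd a - b"
      using that(1,3) mod_eq_dvd_iff_nat[of "x + b" "x + a" n] by simp
    moreover have "a - b < n" using that(2) by simp
    ultimately have "a - b = 0" by (meson nat_dvd_not_less gr0I)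
    then show ?thesis using that(3) by simp
  qed
  show ?thesis
  proof (cases "t \<le> s")
    case True
    show ?thesis by (rule *[OF assms(1,2) True])
  next
    case False
    then have "s \<le> t" by simp
    from *[OF assms(1)[symmetric] assms(3) this] show ?thesis ..
  qed
qed

locale cyclic_set =
  fixes n :: nat and X :: "nat set"
  assumes sub: "X \<subseteq> {..<n}"
begin

text \<open>Forward cyclic distance to the next marked position. Excluding \<open>k = 0\<close>
  makes the gap of a sole marked position a full turn \<open>n\<close>.\<close>

definition gap :: "nat \<Rightarrow> nat" where
  "gap x = (LEAST k. 0 < k \<and> (x + k) mod n \<in> X)"

definition nxt :: "nat \<Rightarrow> nat" where
  "nxt x = (x + gap x) mod n"

lemma lt: "x \<in> X \<Longrightarrow> x < n"
  using sub by auto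

lemma add_mod_surj:
  assumes "x \<in> X" "y \<in> X"
  obtains t where "t < n" "(x + t) mod n = y"
proof
  show "(y + n - x) mod n < n" using lt[OF assms(1)] by simp
  show "(x + (y + n - x) mod n) mod n = y"
    using lt[OF assms(1)] lt[OF assms(2)] by (simp add: mod_add_right_eq)
qed

lemma gap:
  assumes "x \<in> X"
  shows "0 < gap x" "nxt x \<in> X"
proof -
  have "0 < n \<and> (x + n) mod n \<in> X" using assms lt[OF assms] by simp
  then have "0 < gap x \<and> (x + gap x) mod n \<in> X" unfolding gap_def by (rule LeastI)
  then show "0 < gap x" "nxt x \<in> X" by (simp_all add: nxt_def)
qed

lemma gap_le: "0 < k \<Longrightarrow> (x + k) mod n \<in> X \<Longrightarrow> gap x \<le> k"
  unfolding gap_def by (rule Least_le) simp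

lemma gap_minimal: "0 < k \<Longrightarrow> k < gap x \<Longrightarrow> (x + k) mod n \<notin> X"
  using gap_le[of k x] by auto

lemma gap_less:
  assumes "x \<in> X" "y \<in> X" "x \<noteq> y"
  shows "gap x < n"
proof -
  obtain t where t: "t < n" "(x + t) mod n = y" using add_mod_surj[OF assms(1,2)] .
  have "t \<noteq> 0"
  proof
    assume "t = 0"
    then show False using t(2) lt[OF assms(1)] assms(3) by simp
  qed
  then show ?thesis using gap_le[of t x] t assms(2) by simp
qed

lemma nxt_add:
  assumes "gap x \<le> t"
  shows "(nxt x + (t - gap x)) mod n = (x + t) mod n"
proof -
  obtain r where "t = gap x + r" using assms le_Suc_ex by blast
  then show ?thesis by (simp add: nxt_def mod_add_left_eq add.assoc)
qed

text \<open>The marked positions form a single orbit of \<open>nxt\<close>: moving forward from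
  \<open>y\<close> to another mark crosses marks only at successive values of
  \<open>nxt\<close>.\<close>

lemma nxt_closed:
  assumes "Y \<subseteq> X" "Y \<noteq> {}" "\<And>y. y \<in> Y \<Longrightarrow> nxt y \<in> Y"
  shows "Y = X"
proof
  have *: "(y + t) mod n \<in> Y" if "y \<in> Y" "(y + t) mod n \<in> X" for y t
    using that
  proof (induction t arbitrary: y rule: less_induct)
    case (less t)
    have y: "y \<in> X" using less.prems(1) assms(1) by blast
    show ?case
    proof (cases "t = 0")
      case True
      then show ?thesis using less.prems(1) lt[OF y] by simp
    next
      case False
      then have le: "gap y \<le> t" using gap_le less.prems(2) by simp
      then have "(nxt y + (t - gap y)) mod n \<in> Y"
        using less.IH[of "t - gap y" "nxt y"] less.prems gap(1)[OF y] assms(3) nxt_add[OF le]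
        by simp
      then show ?thesis using nxt_add[OF le] by simp
    qed
  qed
  show "X \<subseteq> Y"
  proof
    fix x assume "x \<in> X"
    obtain y where y: "y \<in> Y" using assms(2) by blast
    then obtain t where "(y + t) mod n = x"
      using add_mod_surj[of y x] assms(1) \<open>x \<in> X\<close> by auto
    then show "x \<in> Y" using *[OF y, of t] \<open>x \<in> X\<close> by simp
  qed
qed (rule assms(1))

text \<open>The image of \<open>X\<close> is closed under \<open>nxt\<close>, so it is all of
  \<open>X\<close>; a surjection of a finite set onto itself is injective.\<close>

lemma nxt_inj: "inj_on nxt X"
proof (cases "X = {}")
  case False
  have "nxt ` X = X"
    by (rule nxt_closed) (use False gap(2) in auto)
  moreover have "finite X" using sub finite_subset by blast
  ultimately show ?thesis by (intro eq_card_imp_inj_on) simp_all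
qed simp

text \<open>Summed once around the cycle, the contributions of g cancel.\<close>

lemma cyclic_parity:
  fixes g :: "nat \<Rightarrow> bool"
  assumes g: "\<And>x. x \<in> X \<Longrightarrow> even (gap x) \<longleftrightarrow> (g x \<noteq> g (nxt x))" and "X \<noteq> {}"
  shows "even n \<longleftrightarrow> even (card X)"
proof -
  \<comment> \<open>The start is left out and the end counted, so that a full turn
    \<open>t = n\<close> counts each mark once.\<close>
  define N where "N x t = {s. 0 < s \<and> s \<le> t \<and> (x + s) mod n \<in> X}" for x t
  \<comment> \<open>A gap together with the mark at its end contributes an odd number exactly when
    \<open>g\<close> changes, so the parity of steps plus marks depends only on the values of
    \<open>g\<close> at the two ends.\<close>
  have *: "even (t + card (N x t)) \<longleftrightarrow> g x = g ((x + t) mod n)"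
    if "x \<in> X" "(x + t) mod n \<in> X" for x t
    using that
  proof (induction t arbitrary: x rule: less_induct)
    case (less t)
    show ?case
    proof (cases "t = 0")
      case True
      then have "N x t = {}" by (auto simp: N_def)
      then show ?thesis using True lt[OF less.prems(1)] by simp
    next
      case False
      let ?k = "gap x" and ?y = "nxt x"
      have le: "?k \<le> t" using False less.prems(2) by (intro gap_le) auto
      have fin: "finite (N ?y (t - ?k))" unfolding N_def by (rule finite_subset[of _ "{..t}"]) auto
      have "N x t = insert ?k ((+) ?k ` N ?y (t - ?k))"
      proof (intro subset_antisym subsetI)
        fix s assume s: "s \<in> N x t"
        then have "?k \<le> s" unfolding N_def by (auto intro: gap_le)
        then show "s \<in> insert ?k ((+) ?k ` N ?y (t - ?k))"
          using s nxt_add[of x s] by (cases "s = ?k") (auto simp: N_def intro!: image_eqI[of _ _ "s - ?k"])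
      next
        fix s assume s: "s \<in> insert ?k ((+) ?k ` N ?y (t - ?k))"
        then show "s \<in> N x t"
        proof
          assume "s = ?k"
          then show ?thesis using gap[OF less.prems(1)] le by (simp add: N_def nxt_def)
        next
          assume "s \<in> (+) ?k ` N ?y (t - ?k)"
          then obtain r where "s = ?k + r" "r \<in> N ?y (t - ?k)" by blast
          then show ?thesis using nxt_add[of x s] le by (auto simp: N_def)
        qed
      qed
      moreover have "?k \<notin> (+) ?k ` N ?y (t - ?k)" by (auto simp: N_def)
      ultimately have "card (N x t) = Suc (card (N ?y (t - ?k)))"
        using fin by (simp add: card_image)
      moreover have "even (t - ?k + card (N ?y (t - ?k))) \<longleftrightarrow> g ?y = g ((x + t) mod n)"
        using less.IH[of "t - ?k" ?y] less.prems gap[OF less.prems(1)] False nxt_add[OF le] by simp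
      ultimately show ?thesis
        using g[OF less.prems(1)] le by auto
    qed
  qed
  obtain x where x: "x \<in> X" using assms(2) by blast
  have "bij_betw (\<lambda>s. (x + s) mod n) (N x n) X"
  proof (rule bij_betw_imageI)
    show "inj_on (\<lambda>s. (x + s) mod n) (N x n)"
    proof (rule inj_onI)
      fix s t assume st: "s \<in> N x n" "t \<in> N x n" "(x + s) mod n = (x + t) mod n"
      \<comment> \<open>Here \<open>s\<close> and \<open>t\<close> range over 1 to \<open>n\<close>,
        so both are shifted down by one before cancelling modulo \<open>n\<close>.\<close>
      then have "((x + 1) + (s - 1)) mod n = ((x + 1) + (t - 1)) mod n" by (simp add: N_def)
      then have "s - 1 = t - 1"
        by (rule add_mod_inj) (use st lt[OF x] in \<open>auto simp: N_def\<close>)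
      moreover have "0 < s" "0 < t" using st(1,2) by (simp_all add: N_def)
      ultimately show "s = t" by linarith
    qed
    show "(\<lambda>s. (x + s) mod n) ` N x n = X"
    proof (intro subset_antisym subsetI)
      fix y assume y: "y \<in> X"
      then obtain t where t: "t < n" "(x + t) mod n = y" by (rule add_mod_surj[OF x])
      show "y \<in> (\<lambda>s. (x + s) mod n) ` N x n"
      proof (cases "t = 0")
        case True
        then have "y = (x + n) mod n" using t by simp
        then show ?thesis using y lt[OF x] by (auto simp: N_def intro!: image_eqI[of _ _ n])
      next
        case False
        then show ?thesis using y t by (auto simp: N_def intro!: image_eqI[of _ _ t])
      qed
    qed (auto simp: N_def)
  qed
  then have "card (N x n) = card X" by (rule bij_betw_same_card)
  moreover have "(x + n) mod n = x" using lt[OF x] by simp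
  ultimately show ?thesis using *[of x n] x by simp
qed

text \<open>An arc from a mark to the next one has no mark in its interior. If two such arcs shared
  a point, backing up from it would place the start of one arc on the other, hence at an end of
  it.\<close>

lemma arcs_disjoint:
  assumes "x \<in> X" "y \<in> X" "x \<noteq> y" "nxt x \<noteq> y" "nxt y \<noteq> x" "s \<le> gap x" "t \<le> gap y"
  shows "(x + s) mod n \<noteq> (y + t) mod n"
proof
  assume eq: "(x + s) mod n = (y + t) mod n"
  have aux: False if "x \<in> X" "y \<in> X" "x \<noteq> y" "nxt y \<noteq> x" "nxt x \<noteq> nxt y" "s \<le> t"
    "s \<le> gap x" "t \<le> gap y" "(x + s) mod n = (y + t) mod n" for x y s t
  proof -
    obtain r where r: "t = s + r" using \<open>s \<le> t\<close> le_Suc_ex by blast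
    have "s + (y + r) = y + t" "s + x = x + s" using r by simp_all
    then have "(s + x) mod n = (s + (y + r) mod n) mod n"
      using that(9) by (metis mod_add_right_eq)
    then have "x = (y + r) mod n"
      by (rule add_mod_inj) (use lt[OF that(1)] in auto)
    then have ts: "(y + (t - s)) mod n = x" using r by simp
    show False
    proof (cases "t - s = gap y")
      case True
      then show ?thesis using ts that(4) by (simp add: nxt_def)
    next
      case False
      then have "t - s < gap y" using that(8) by simp
      then have "t - s = 0" using gap_minimal[of "t - s" y] ts that(1) by (metis gr0I)
      then show ?thesis using ts that(3) lt[OF that(2)] by simp
    qed
  qed
  have ne: "nxt x \<noteq> nxt y" using inj_onD[OF nxt_inj _ assms(1,2)] assms(3) by auto
  show False
  proof (cases "s \<le> t")
    case True
    show ?thesis by (rule aux[OF assms(1-3,5) ne True assms(6,7) eq])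
  next
    case False
    then have "t \<le> s" by simp
    show ?thesis
      by (rule aux[OF assms(2,1) assms(3)[symmetric] assms(4) ne[symmetric] \<open>t \<le> s\<close> assms(7,6) eq[symmetric]])
  qed
qed

text \<open>If two switches of opposite parity were always consecutive, then the switches around x and y
  below would exhaust X.\<close>

lemma disjoint_switches_of_opposite_parity:
  assumes side: "3 \<le> card {x \<in> X. \<sigma> x}" "3 \<le> card {x \<in> X. \<not> \<sigma> x}"
    and "odd n" "even (card X)"
    and same: "\<And>x. x \<in> X \<Longrightarrow> \<sigma> (nxt x) \<longleftrightarrow> \<sigma> x \<Longrightarrow> odd (gap x)"
  shows "\<exists>x\<in>X. \<exists>y\<in>X. x \<noteq> y \<and> nxt x \<noteq> y \<and> nxt y \<noteq> x \<and>
    \<sigma> (nxt x) \<noteq> \<sigma> x \<and> \<sigma> (nxt y) \<noteq> \<sigma> y \<and> odd (gap x) \<and> even (gap y)"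
proof (rule ccontr)
  assume no_pair: "\<not> ?thesis"
  define Sw where "Sw = {x \<in> X. \<sigma> (nxt x) \<noteq> \<sigma> x}"
  have adj: "nxt x = y \<or> nxt y = x" if "x \<in> Sw" "y \<in> Sw" "odd (gap x) \<noteq> odd (gap y)" for x y
  proof -
    have *: "nxt x = y \<or> nxt y = x" if "x \<in> Sw" "y \<in> Sw" "odd (gap x)" "even (gap y)" for x y
      using that no_pair unfolding Sw_def by auto
    show ?thesis using *[of x y] *[of y x] that by (cases "odd (gap x)") auto
  qed
  have "X \<noteq> {}" using side(1) by auto
  \<comment> \<open>If all switches had even gaps, gap parity would record exactly the changes of
    \<open>\<sigma>\<close>, and the parity count would contradict odd \<open>n\<close> with even
    \<open>card X\<close>.\<close>
  have "\<exists>x\<in>Sw. odd (gap x)"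
  proof (rule ccontr)
    assume "\<not> ?thesis"
    then have "even (gap x) \<longleftrightarrow> (\<sigma> x \<noteq> \<sigma> (nxt x))" if "x \<in> X" for x
      using same[OF that] that by (auto simp: Sw_def)
    then show False using cyclic_parity[of \<sigma>] \<open>X \<noteq> {}\<close> assms(3,4) by blast
  qed
  then obtain p where p: "p \<in> Sw" "odd (gap p)" by blast
  \<comment> \<open>If all switches had odd gaps, every gap would be odd, and the count with a
    constant function gives the same contradiction.\<close>
  have "\<exists>x\<in>Sw. even (gap x)"
  proof (rule ccontr)
    assume "\<not> ?thesis"
    then have "even (gap x) \<longleftrightarrow> False \<noteq> False" if "x \<in> X" for x
      using same[OF that] that by (auto simp: Sw_def)
    then show False using cyclic_parity[of "\<lambda>_. False"] \<open>X \<noteq> {}\<close> assms(3,4) by blast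
  qed
  then obtain q where q: "q \<in> Sw" "even (gap q)" by blast
  have "\<exists>x y. x \<in> Sw \<and> y \<in> Sw \<and> nxt x = y \<and> odd (gap x) \<noteq> odd (gap y)"
    using adj[of p q] p q by metis
  then obtain x y where x: "x \<in> Sw" and y: "y \<in> Sw" "nxt x = y" "odd (gap x) \<noteq> odd (gap y)"
    by blast
  have X: "x \<in> X" "y \<in> X" and xy: "\<sigma> y \<noteq> \<sigma> x" using x y by (auto simp: Sw_def)
  \<comment> \<open>Any other switch has gap parity opposite to that of \<open>x\<close> or of
    \<open>y\<close>, so it is consecutive to one of them; injectivity of \<open>nxt\<close> leaves
    only the place just before \<open>x\<close> or just after \<open>y\<close>.\<close>
  have other: "nxt w = x \<or> w = nxt y" if w: "w \<in> Sw" "w \<noteq> x" "w \<noteq> y" for w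
  proof (cases "odd (gap w) = odd (gap x)")
    case True
    then have "nxt w = y \<or> nxt y = w" using adj[OF w(1) y(1)] y(3) by auto
    then show ?thesis
      using y(2) w X nxt_inj by (auto simp: inj_on_def Sw_def)
  next
    case False
    then have "nxt w = x \<or> nxt x = w" using adj[OF w(1) x] by auto
    then show ?thesis using y(2) w(3) by auto
  qed
  have big: "\<exists>w. w \<in> X \<and> \<sigma> w = b \<and> w \<noteq> v" for b v
  proof (rule ccontr)
    assume "\<not> ?thesis"
    then have "{w \<in> X. \<sigma> w = b} \<subseteq> {v}" by blast
    then have "card {w \<in> X. \<sigma> w = b} \<le> 1" using card_mono[of "{v}"] by fastforce
    then show False using side by (cases b) auto
  qed
  \<comment> \<open>When \<open>u\<close> is entered only from the other side, some other mark on
    its side must be a switch; otherwise these other marks would form a nonempty proper subset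
    closed under \<open>nxt\<close>.\<close>
  have run: "\<exists>w\<in>Sw. \<sigma> w = \<sigma> u \<and> w \<noteq> u" if u: "u \<in> X"
    and nu: "\<And>w. w \<in> X \<Longrightarrow> nxt w = u \<Longrightarrow> \<sigma> w \<noteq> \<sigma> u" for u
  proof (rule ccontr)
    assume no: "\<not> ?thesis"
    define Y where "Y = {w \<in> X. \<sigma> w = \<sigma> u \<and> w \<noteq> u}"
    have "Y \<noteq> {}" using big[of "\<sigma> u" u] by (auto simp: Y_def)
    then have "Y = X"
    proof (rule nxt_closed[rotated])
      show "Y \<subseteq> X" by (auto simp: Y_def)
      show "nxt w \<in> Y" if "w \<in> Y" for w
        using that no nu gap(2) by (auto simp: Y_def Sw_def)
    qed
    then show False using u by (auto simp: Y_def)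
  qed
  have ny: "nxt w = y \<longleftrightarrow> w = x" if "w \<in> X" for w
    using y(2) nxt_inj X that by (auto simp: inj_on_def)
  obtain a where a: "a \<in> Sw" "\<sigma> a = \<sigma> y" "a \<noteq> y"
    using run[of y] X ny xy by metis
  have "\<sigma> (nxt y) = \<sigma> x" using y(1) xy by (auto simp: Sw_def)
  have ax: "nxt a = x"
    using other[OF a(1)] a xy \<open>\<sigma> (nxt y) = \<sigma> x\<close> by metis
  have na: "nxt w = x \<longleftrightarrow> w = a" if "w \<in> X" for w
    using ax nxt_inj a(1) that by (auto simp: inj_on_def Sw_def)
  obtain b where b: "b \<in> Sw" "\<sigma> b = \<sigma> x" "b \<noteq> x"
    using run[of x] X na a(2) xy by metis
  have yb: "b = nxt y"
    using other[OF b(1,3)] b xy a(2) na[of b] by (auto simp: Sw_def)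
  have "odd (gap a) = odd (gap y) \<and> odd (gap b) = odd (gap x)"
  proof (intro conjI; rule ccontr)
    assume "odd (gap a) \<noteq> odd (gap y)"
    then have "nxt a = y \<or> nxt y = a" using adj[OF a(1) y(1)] by simp
    then show False using ax a(2) xy yb b(2) by metis
  next
    assume "odd (gap b) \<noteq> odd (gap x)"
    then have "nxt b = x \<or> nxt x = b" using adj[OF b(1) x] by simp
    then show False using na[of b] b a(2) xy y(2) by (auto simp: Sw_def)
  qed
  \<comment> \<open>\<open>a\<close> and \<open>b\<close> again have opposite gap parities, so they
    are consecutive. This closes the orbit \<open>x, y, b, a\<close>, with only two marks on each
    side instead of at least three.\<close>
  then have "nxt a = b \<or> nxt b = a" using adj[OF a(1) b(1)] y(3) by auto
  then have ba: "nxt b = a" using ax b(3) by auto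
  have "{x, y, a, b} = X"
    by (rule nxt_closed) (use X a b ax yb ba y(2) in \<open>auto simp: Sw_def\<close>)
  then have "{w \<in> X. \<sigma> w = \<sigma> x} \<subseteq> {x, b}" using a(2) xy by auto
  then have "card {w \<in> X. \<sigma> w = \<sigma> x} \<le> card {x, b}" by (rule card_mono[rotated]) simp
  also have "\<dots> \<le> 2" using card_insert_le_m1[of 2 "{b}" x] by simp
  finally show False using side by (cases "\<sigma> x") auto
qed

end

section \<open>Minimal odd strong cycles\<close>

definition linked :: "'a set set \<Rightarrow> 'a set \<Rightarrow> 'a \<Rightarrow> 'a \<Rightarrow> bool" where
  "linked \<F> W x y \<longleftrightarrow> x \<noteq> y \<and> (\<exists>F\<in>\<F>. F \<inter> W = {x, y})"

text \<open>The pattern forbidden by \<open>balanced\<close>, written as a vertex list. Edges appear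
  only through their traces of size two on the list, so that minimality can be phrased by vertex
  sets alone.\<close>

definition odd_strong_cycle :: "'a set set \<Rightarrow> 'a list \<Rightarrow> bool" where
  "odd_strong_cycle \<F> ws \<longleftrightarrow> odd (length ws) \<and> 3 \<le> length ws \<and> distinct ws \<and>
     successively (linked \<F> (set ws)) ws \<and> linked \<F> (set ws) (last ws) (hd ws)"

lemma linked_sym: "linked \<F> W x y \<longleftrightarrow> linked \<F> W y x"
  by (auto simp: linked_def insert_commute)

lemma linkedI: "F \<in> \<F> \<Longrightarrow> F \<inter> W = {x, y} \<Longrightarrow> x \<noteq> y \<Longrightarrow> linked \<F> W x y"
  unfolding linked_def by blast

text \<open>Since \<open>m\<close> is at least 3, the column pairs \<open>{s, Suc s mod m}\<close>
  differ for different \<open>s\<close>, so the rows are distinct vertices; column \<open>t\<close>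
  has as its trace the row \<open>t\<close> and its cyclic predecessor.\<close>

lemma unbalanced_imp_odd_strong_cycle:
  assumes "\<not> balanced V \<F> (\<in>)"
  obtains ws where "set ws \<subseteq> V" "odd_strong_cycle \<F> ws"
proof -
  from assms obtain m v Q where m: "odd m" "3 \<le> m" and mem: "\<forall>t<m. v t \<in> V \<and> Q t \<in> \<F>"
    and inc: "\<forall>s<m. \<forall>t<m. v s \<in> Q t \<longleftrightarrow> t = s \<or> t = Suc s mod m"
    unfolding balanced_def by blast
  have inj: "s = t" if "s < m" "t < m" "v s = v t" for s t
  proof (rule ccontr)
    assume "s \<noteq> t"
    have *: "Suc s mod m < m" "Suc t mod m < m" using m(2) by simp_all
    have "t = Suc s mod m" "s = Suc t mod m"
      using inc[rule_format, OF that(1,2)] inc[rule_format, OF that(2,2)]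
        inc[rule_format, OF that(2,1)] inc[rule_format, OF that(1,1)] that(3) \<open>s \<noteq> t\<close> by auto
    then show False
      using that(1,2) m(2) by (auto simp: mod_Suc split: if_splits)
  qed
  define ws where "ws = map v [0..<m]"
  have dist: "distinct ws"
    unfolding ws_def distinct_map by (auto intro!: inj_onI inj)
  have link: "linked \<F> (set ws) (v s) (v t)" if s: "s < m" "t < m" "t = Suc s mod m" for s t
  proof (rule linkedI)
    show "Q t \<in> \<F>" using mem s by blast
    show "v s \<noteq> v t"
      using inj[OF s(1,2)] s(1,3) m(2) by (auto simp: mod_Suc split: if_splits)
    have "r = s \<or> r = t" if "r < m" "v r \<in> Q t" for r
    proof -
      have "t = r \<or> t = Suc r mod m" using inc that s(2) by blast
      then show ?thesis
        using s that(1) by (auto simp: mod_Suc split: if_splits)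
    qed
    moreover have "v s \<in> Q t" "v t \<in> Q t" using inc s by auto
    ultimately show "Q t \<inter> set ws = {v s, v t}"
      using s(1,2) unfolding ws_def by fastforce
  qed
  show thesis
  proof (rule that)
    show "set ws \<subseteq> V" using mem by (auto simp: ws_def)
    have "successively (linked \<F> (set ws)) ws"
      unfolding successively_conv_nth
    proof (intro allI impI)
      fix s assume "Suc s < length ws"
      then show "linked \<F> (set ws) (ws ! s) (ws ! Suc s)"
        using link[of s "Suc s"] by (simp add: ws_def)
    qed
    moreover have "linked \<F> (set ws) (last ws) (hd ws)"
      using link[of "m - 1" 0] m(2) by (simp add: ws_def last_map hd_map)
    ultimately show "odd_strong_cycle \<F> ws"
      using m dist unfolding odd_strong_cycle_def by (simp add: ws_def)
  qed
qed

text \<open>\<open>c\<close> runs around the rim and \<open>\<F>\<close> stands for the maximal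
  cliques. Of the graph there remain linearity, the rim edges, and the fact that every odd strong
  cycle covers the whole rim.\<close>

locale minimal_rim =
  fixes n :: nat and c :: "nat \<Rightarrow> 'a" and \<F> :: "'a set set"
  assumes odd_n: "odd n" and inj: "inj_on c {..<n}"
    and rim: "\<And>i. i < n \<Longrightarrow> {c i, c (Suc i mod n)} \<in> \<F>"
    and members: "\<And>Q. Q \<in> \<F> \<Longrightarrow> Q \<subseteq> c ` {..<n}"
    and linear: "\<And>P Q x y. P \<in> \<F> \<Longrightarrow> Q \<in> \<F> \<Longrightarrow> {x, y} \<subseteq> P \<Longrightarrow> {x, y} \<subseteq> Q \<Longrightarrow> x \<noteq> y \<Longrightarrow> P = Q"
    and minimal: "\<And>ws. odd_strong_cycle \<F> ws \<Longrightarrow> set ws \<subseteq> c ` {..<n} \<Longrightarrow> c ` {..<n} \<subseteq> set ws"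
begin

lemma n_pos: "0 < n"
  using odd_n by (cases n) auto

lemma c_eq_iff: "i < n \<Longrightarrow> j < n \<Longrightarrow> c i = c j \<longleftrightarrow> i = j"
  using inj by (auto simp: inj_on_def)

text \<open>The form in which minimality is applied: an odd strong cycle covers the rim and hence
  all of \<open>A\<close>, which is too large to meet it in at most two vertices.\<close>

lemma no_odd_strong_cycle:
  assumes "A \<in> \<F>" "3 \<le> card A" "odd_strong_cycle \<F> ws" "set ws \<subseteq> c ` {..<n}"
    and "A \<inter> set ws \<subseteq> {x, y}"
  shows False
proof -
  have "A \<subseteq> {x, y}" using minimal[OF assms(3,4)] members[OF assms(1)] assms(5) by blast
  then have "card A \<le> card {x, y}" by (rule card_mono[rotated]) simp
  also have "\<dots> \<le> 2" using card_insert_le_m1[of 2 "{y}" x] by simp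
  finally show False using assms(2) by simp
qed

text \<open>\<open>k\<close> counts edges, so there are \<open>k + 1\<close> vertices; the parities
  of the N-conditions, stated for numbers of vertices, are reversed for \<open>k\<close>.\<close>

definition arc :: "nat \<Rightarrow> nat \<Rightarrow> 'a list" where
  "arc i k = map (\<lambda>t. c ((i + t) mod n)) [0..<Suc k]"

lemma arc_simps [simp]:
  "length (arc i k) = Suc k" "arc i k \<noteq> []" "hd (arc i k) = c (i mod n)"
  "last (arc i k) = c ((i + k) mod n)"
  unfolding arc_def by (simp_all add: hd_conv_nth last_conv_nth nth_append del: upt_Suc)

lemma set_arc: "set (arc i k) = {c ((i + t) mod n) |t. t \<le> k}"
  unfolding arc_def by (auto simp: less_Suc_eq_le simp del: upt_Suc)

lemma set_arc_subset: "set (arc i k) \<subseteq> c ` {..<n}"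
  using n_pos unfolding set_arc by auto

lemma distinct_arc:
  assumes "k < n"
  shows "distinct (arc i k)"
  unfolding arc_def distinct_map
proof (intro conjI inj_onI distinct_upt)
  fix s t assume st: "s \<in> set [0..<Suc k]" "t \<in> set [0..<Suc k]" "c ((i + s) mod n) = c ((i + t) mod n)"
  then have "(i + s) mod n = (i + t) mod n" using c_eq_iff n_pos by simp
  then show "s = t" by (rule add_mod_inj) (use st(1,2) assms in auto)
qed

text \<open>A rim edge with both ends in \<open>W\<close> is its own trace on
  \<open>W\<close>.\<close>

lemma successively_arc:
  assumes "set (arc i k) \<subseteq> W" "k < n"
  shows "successively (linked \<F> W) (arc i k)"
  unfolding successively_conv_nth
proof (intro allI impI)
  fix t assume t: "Suc t < length (arc i k)"
  let ?p = "(i + t) mod n"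
  have nth: "arc i k ! t = c ?p" "arc i k ! Suc t = c (Suc ?p mod n)"
    using t by (simp_all add: arc_def mod_Suc_eq del: upt_Suc)
  have "{arc i k ! t, arc i k ! Suc t} \<subseteq> set (arc i k)"
    using t by (simp del: arc_simps(1))
  then have "{c ?p, c (Suc ?p mod n)} \<inter> W = {c ?p, c (Suc ?p mod n)}"
    using assms(1) unfolding nth by blast
  moreover have "c ?p \<noteq> c (Suc ?p mod n)"
    using distinct_arc[OF assms(2), of i] t unfolding nth[symmetric] by (simp add: nth_eq_iff_index_eq)
  moreover have "{c ?p, c (Suc ?p mod n)} \<in> \<F>" using rim n_pos by simp
  ultimately show "linked \<F> W (arc i k ! t) (arc i k ! Suc t)"
    unfolding nth by (intro linkedI)
qed

text \<open>An even \<open>k\<close> gives an odd number of vertices, and \<open>A\<close> supplies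
  the missing link from the last vertex to the first.\<close>

lemma odd_strong_cycle_one_arc:
  assumes "A \<in> \<F>" "2 \<le> k" "even k" "k < n" "A \<inter> set (arc i k) = {c (i mod n), c ((i + k) mod n)}"
  shows "odd_strong_cycle \<F> (arc i k)"
proof -
  have "linked \<F> (set (arc i k)) (c ((i + k) mod n)) (c (i mod n))"
  proof (rule linkedI[OF assms(1)])
    show "A \<inter> set (arc i k) = {c ((i + k) mod n), c (i mod n)}"
      using assms(5) by (simp add: insert_commute)
    have "arc i k ! 0 \<noteq> arc i k ! k"
      using distinct_arc[OF assms(4), of i] assms(2) by (simp add: nth_eq_iff_index_eq)
    then show "c ((i + k) mod n) \<noteq> c (i mod n)"
      by (simp add: arc_def nth_append del: upt_Suc)
  qed
  then show ?thesis
    using assms(2-4) distinct_arc successively_arc[OF order_refl assms(4)]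
    unfolding odd_strong_cycle_def by simp
qed

lemma rim_consecutive:
  assumes "A \<in> \<F>" "c i \<in> A" "c (Suc i mod n) \<in> A" "i < n" "1 < n"
  shows "A = {c i, c (Suc i mod n)}"
proof (rule linear[OF assms(1) rim[OF assms(4)]])
  show "c i \<noteq> c (Suc i mod n)"
    using assms(4,5) c_eq_iff[of i "Suc i mod n"] by (auto simp: mod_Suc split: if_splits)
qed (use assms(2,3) in auto)

lemma arc_inter_ends:
  assumes "0 < k" "c (i mod n) \<in> A" "c ((i + k) mod n) \<in> A"
    and "\<And>j. 0 < j \<Longrightarrow> j < k \<Longrightarrow> c ((i + j) mod n) \<notin> A"
  shows "A \<inter> set (arc i k) = {c (i mod n), c ((i + k) mod n)}"
proof (intro subset_antisym subsetI)
  fix x assume "x \<in> A \<inter> set (arc i k)"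
  then obtain t where t: "t \<le> k" "x = c ((i + t) mod n)" "x \<in> A" unfolding set_arc by blast
  then have "t = 0 \<or> t = k" using assms(4)[of t] by (cases "t = 0"; cases "t = k") auto
  then show "x \<in> {c (i mod n), c ((i + k) mod n)}" using t(2) by auto
next
  fix x assume "x \<in> {c (i mod n), c ((i + k) mod n)}"
  moreover have "c ((i + 0) mod n) \<in> set (arc i k)" "c ((i + k) mod n) \<in> set (arc i k)"
    unfolding set_arc by blast+
  ultimately show "x \<in> A \<inter> set (arc i k)" using assms(2,3) by auto
qed

text \<open>For even \<open>k\<close> the arc closed by \<open>A\<close> would be an odd strong
  cycle meeting \<open>A\<close> only twice; \<open>k = 1\<close> would make \<open>A\<close> share
  two vertices with a rim edge and equal it by linearity. This yields N1.\<close>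

lemma AA_path_length:
  assumes A: "A \<in> \<F>" "3 \<le> card A" and k: "0 < k" "k < n" and "i < n"
    and ends: "c i \<in> A" "c ((i + k) mod n) \<in> A"
    and free: "\<And>j. 0 < j \<Longrightarrow> j < k \<Longrightarrow> c ((i + j) mod n) \<notin> A"
  shows "odd k" "3 \<le> k"
proof -
  have "k \<noteq> 1"
  proof
    assume "k = 1"
    then have "A = {c i, c (Suc i mod n)}"
      using rim_consecutive[OF A(1) ends(1) _ \<open>i < n\<close>] ends(2) k by simp
    then have "card A \<le> 2" using card_insert_le_m1[of 2 "{c (Suc i mod n)}" "c i"] by simp
    then show False using A(2) by simp
  qed
  then have "2 \<le> k" using k(1) by simp
  have inter: "A \<inter> set (arc i k) = {c (i mod n), c ((i + k) mod n)}"
    by (rule arc_inter_ends[OF k(1) _ ends(2) free]) (use ends(1) \<open>i < n\<close> in auto)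
  show "odd k"
  proof
    assume "even k"
    from odd_strong_cycle_one_arc[OF A(1) \<open>2 \<le> k\<close> this k(2) inter] show False
      by (rule no_odd_strong_cycle[OF A _ set_arc_subset]) (rule equalityD1[OF inter])
  qed
  then show "3 \<le> k" using \<open>2 \<le> k\<close> by presburger
qed

text \<open>Two vertices split the odd rim into two arcs, one of which has an even number of edges.
  That arc closed by \<open>Q\<close> is an odd strong cycle and so covers the rim, which leaves a
  single edge for the other arc.\<close>

lemma card_2_imp_rim:
  assumes "Q \<in> \<F>" "card Q = 2"
  shows "\<exists>i<n. Q = {c i, c (Suc i mod n)}"
proof -
  obtain x y where xy: "Q = {x, y}" "x \<noteq> y" using assms(2) by (auto simp: card_2_iff)
  have arc: "\<exists>i<n. Q = {c i, c (Suc i mod n)}"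
    if i: "i < n" "0 < k" "k < n" "Q = {c i, c ((i + k) mod n)}" "even k" for i k
  proof -
    have "distinct (arc i k)" using distinct_arc i by simp
    have inter: "Q \<inter> set (arc i k) = {c (i mod n), c ((i + k) mod n)}"
    proof (rule arc_inter_ends)
      fix j assume j: "0 < j" "j < k"
      have "c ((i + j) mod n) \<noteq> c i"
        using c_eq_iff[of "(i + j) mod n" i] add_mod_inj[of i j n 0] i j by auto
      moreover have "c ((i + j) mod n) \<noteq> c ((i + k) mod n)"
        using c_eq_iff[of "(i + j) mod n" "(i + k) mod n"] add_mod_inj[of i j n k] i j by auto
      ultimately show "c ((i + j) mod n) \<notin> Q" using i(4) by auto
    qed (use i in auto)
    have "2 \<le> k" using i(2,5) by presburger
    have "odd_strong_cycle \<F> (arc i k)"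
      by (rule odd_strong_cycle_one_arc[OF assms(1) \<open>2 \<le> k\<close> i(5,3) inter])
    then have "c ` {..<n} \<subseteq> set (arc i k)" by (rule minimal[OF _ set_arc_subset])
    then have "card (c ` {..<n}) \<le> card (set (arc i k))" by (intro card_mono) auto
    then have "n \<le> Suc k"
      using distinct_arc[OF i(3), of i] inj by (simp add: card_image distinct_card)
    then have "n = Suc k" using i(3) by simp
    then have "Suc (i + k) = i + n" by simp
    then have "Suc ((i + k) mod n) mod n = i"
      using i(1) by (simp only: mod_Suc_eq) simp
    then show ?thesis
      using i(4) n_pos by (intro exI[of _ "(i + k) mod n"]) auto
  qed
  obtain i j where ij: "i < n" "x = c i" "j < n" "y = c j"
    using members[OF assms(1)] xy(1) by auto
  have main: "\<exists>i<n. Q = {c i, c (Suc i mod n)}" if "i < j" "j < n" "Q = {c i, c j}" for i j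
  proof (cases "even (j - i)")
    case True
    show ?thesis by (rule arc[of i "j - i"]) (use that True in auto)
  next
    case False
    show ?thesis by (rule arc[of j "n - (j - i)"]) (use that False odd_n in \<open>auto simp: insert_commute\<close>)
  qed
  show ?thesis
  proof (cases "i < j")
    case True
    then show ?thesis using main[of i j] ij xy(1) by simp
  next
    case False
    then have "j < i" using ij xy(2) by (cases "i = j") auto
    then show ?thesis using main[of j i] ij xy(1) by (simp add: insert_commute)
  qed
qed

definition positions :: "'a set \<Rightarrow> nat set" where
  "positions A = {i. i < n \<and> c i \<in> A}"

lemma card_positions:
  assumes "A \<subseteq> c ` {..<n}"
  shows "card (positions A) = card A"
proof -
  have "c ` positions A = A" using assms by (auto simp: positions_def)
  moreover have "inj_on c (positions A)"
    using inj by (rule inj_on_subset) (auto simp: positions_def)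
  ultimately show ?thesis by (metis card_image)
qed

text \<open>Between consecutive marks that both lie in \<open>A\<close> the arc has no interior
  vertex in \<open>A\<close>, so it is an \<open>A\<close>-path; a second vertex of \<open>A\<close>
  keeps it shorter than a full turn.\<close>

lemma odd_gap:
  assumes X: "X = positions (\<Union>\<A>)" and A: "A \<in> \<A>" "A \<in> \<F>" "3 \<le> card A"
    and x: "x < n" "c x \<in> A" "c (cyclic_set.nxt n X x) \<in> A"
  shows "odd (cyclic_set.gap n X x)"
proof -
  interpret cyclic_set n X by unfold_locales (auto simp: X positions_def)
  have xX: "x \<in> X" using x A(1) by (auto simp: X positions_def)
  have "\<not> A \<subseteq> {c x}"
  proof
    assume "A \<subseteq> {c x}"
    then have "card A \<le> 1" using card_mono[of "{c x}" A] by simp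
    then show False using A(3) by simp
  qed
  then obtain y where "y < n" "c y \<in> A" "y \<noteq> x" using members[OF A(2)] by blast
  then have "gap x < n" using A(1) by (intro gap_less[OF xX, of y]) (auto simp: X positions_def)
  moreover have "c ((x + j) mod n) \<notin> A" if "0 < j" "j < gap x" for j
    using gap_minimal[OF that] A(1) n_pos by (auto simp: X positions_def)
  ultimately show ?thesis
    using AA_path_length(1)[OF A(2,3) gap(1)[OF xX], of x] x by (simp add: nxt_def)
qed

text \<open>All gaps around \<open>A\<close> are odd, so the parity count with a constant function
  ties the parity of \<open>card A\<close> to that of \<open>n\<close>. This is N2.\<close>

lemma odd_card_inscribed:
  assumes A: "A \<in> \<F>" "3 \<le> card A"
  shows "odd (card A)"
proof -
  define X where "X = positions (\<Union>{A})"
  interpret cyclic_set n X by unfold_locales (auto simp: X_def positions_def)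
  have card: "card X = card A" using card_positions[OF members[OF A(1)]] by (simp add: X_def)
  have "even n \<longleftrightarrow> even (card X)"
  proof (rule cyclic_parity[of "\<lambda>_. False"])
    fix x assume x: "x \<in> X"
    have "c (nxt x) \<in> A" using gap(2)[OF x] by (simp add: X_def positions_def)
    then have "odd (gap x)"
      using odd_gap[OF X_def _ A, of x] x by (simp add: X_def positions_def)
    then show "even (gap x) \<longleftrightarrow> False \<noteq> False" by simp
  qed (use card A(2) in auto)
  then show ?thesis using card odd_n by simp
qed

text \<open>The two lists are joined into a ring by \<open>B\<close> at the middle seam and by
  \<open>A\<close> at the outer one.\<close>

lemma odd_strong_cycle_two_arcs:
  assumes A: "A \<in> \<F>" "A \<inter> set (us @ vs) = {last vs, hd us}" "last vs \<noteq> hd us"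
    and B: "B \<in> \<F>" "B \<inter> set (us @ vs) = {last us, hd vs}" "last us \<noteq> hd vs"
    and ne: "us \<noteq> []" "vs \<noteq> []"
    and "distinct us" "distinct vs" "set us \<inter> set vs = {}" "odd (length (us @ vs))" "3 \<le> length (us @ vs)"
    and "successively (linked \<F> (set (us @ vs))) us" "successively (linked \<F> (set (us @ vs))) vs"
  shows "odd_strong_cycle \<F> (us @ vs)"
  unfolding odd_strong_cycle_def successively_append_iff
  using assms linkedI[OF A] linkedI[OF B] by simp

text \<open>With \<open>k\<close> odd the arc has an even number of vertices. Adding
  \<open>\<xi>\<close>, linked through \<open>A\<close> to one end and through \<open>B\<close> to
  the other, would give an odd strong cycle. This is N5.\<close>

lemma even_AB_path_length:
  assumes A: "A \<in> \<F>" "3 \<le> card A" and B: "B \<in> \<F>" and AB: "A \<inter> B = {\<xi>}"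
    and k: "k < n" and i: "i < n" "c i \<in> A - B" "c ((i + k) mod n) \<in> B - A"
    and free: "\<And>j. 0 < j \<Longrightarrow> j < k \<Longrightarrow> c ((i + j) mod n) \<notin> A \<union> B"
  shows "even k"
proof (rule ccontr)
  assume "odd k"
  have mem: "x \<in> set (arc i k) \<longleftrightarrow> x = c i \<or> x = c ((i + k) mod n) \<or>
    (\<exists>j. 0 < j \<and> j < k \<and> x = c ((i + j) mod n))" for x
  proof
    assume "x \<in> set (arc i k)"
    then obtain t where t: "t \<le> k" "x = c ((i + t) mod n)" unfolding set_arc by blast
    then show "x = c i \<or> x = c ((i + k) mod n) \<or> (\<exists>j. 0 < j \<and> j < k \<and> x = c ((i + j) mod n))"
      using \<open>i < n\<close> by (cases "t = 0"; cases "t = k") auto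
  next
    assume "x = c i \<or> x = c ((i + k) mod n) \<or> (\<exists>j. 0 < j \<and> j < k \<and> x = c ((i + j) mod n))"
    then have "\<exists>t\<le>k. x = c ((i + t) mod n)"
      using \<open>i < n\<close> by (elim disjE exE) (auto intro: exI[of _ 0] less_imp_le)
    then show "x \<in> set (arc i k)" unfolding set_arc by blast
  qed
  have interA: "A \<inter> set (arc i k) = {c i}" and interB: "B \<inter> set (arc i k) = {c ((i + k) mod n)}"
    using mem i free by auto
  have \<xi>: "\<xi> \<in> A" "\<xi> \<in> B" using AB by auto
  have "\<xi> \<notin> set (arc i k)"
  proof
    assume "\<xi> \<in> set (arc i k)"
    then have "\<xi> \<in> {c i}" using interA \<xi>(1) by blast
    then show False using i(2) \<xi>(2) by simp
  qed
  moreover have "\<xi> \<noteq> c i" "\<xi> \<noteq> c ((i + k) mod n)" using \<xi> i by auto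
  ultimately have "odd_strong_cycle \<F> (arc i k @ [\<xi>])"
    using \<open>odd k\<close> odd_pos[OF \<open>odd k\<close>] \<xi> interA interB i(1) k successively_arc[of i k "set (arc i k @ [\<xi>])"] distinct_arc
    by (intro odd_strong_cycle_two_arcs[OF A(1) _ _ B]) auto
  moreover have "set (arc i k @ [\<xi>]) \<subseteq> c ` {..<n}"
    using set_arc_subset[of i k] members[OF A(1)] \<xi>(1) by auto
  moreover have "A \<inter> set (arc i k @ [\<xi>]) \<subseteq> {\<xi>, c i}" using interA by auto
  ultimately show False by (rule no_odd_strong_cycle[OF A])
qed

text \<open>Disjoint \<open>A\<close> and \<open>B\<close> would occupy an even number of positions
  on an odd rim, with odd gaps within each clique. Then there are two disjoint arcs between the
  cliques with opposite gap parity; together they have an odd number of vertices, and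
  \<open>A\<close> and \<open>B\<close> link their ends into an odd strong cycle.\<close>

lemma inscribed_intersect:
  assumes A: "A \<in> \<F>" "3 \<le> card A" and B: "B \<in> \<F>" "3 \<le> card B"
  shows "A \<inter> B \<noteq> {}"
proof
  assume disj: "A \<inter> B = {}"
  define X where "X = positions (\<Union>{A, B})"
  interpret cyclic_set n X by unfold_locales (auto simp: X_def positions_def)
  have X: "x \<in> X \<longleftrightarrow> x < n \<and> (c x \<in> A \<or> c x \<in> B)" for x by (auto simp: X_def positions_def)
  have sides: "{x \<in> X. c x \<in> A} = positions A" "{x \<in> X. c x \<notin> A} = positions B"
    using X disj by (auto simp: positions_def)
  have cards: "card (positions A) = card A" "card (positions B) = card B"
    using card_positions members A(1) B(1) by auto
  have "X = positions A \<union> positions B" "positions A \<inter> positions B = {}"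
    using disj by (auto simp: X positions_def)
  moreover have "finite (positions A)" "finite (positions B)" by (simp_all add: positions_def)
  ultimately have cardX: "card X = card A + card B" using cards by (simp add: card_Un_disjoint)
  have "\<exists>x\<in>X. \<exists>y\<in>X. x \<noteq> y \<and> nxt x \<noteq> y \<and> nxt y \<noteq> x \<and>
    (c (nxt x) \<in> A) \<noteq> (c x \<in> A) \<and> (c (nxt y) \<in> A) \<noteq> (c y \<in> A) \<and> odd (gap x) \<and> even (gap y)"
  proof (rule disjoint_switches_of_opposite_parity)
    show "3 \<le> card {x \<in> X. c x \<in> A}" "3 \<le> card {x \<in> X. c x \<notin> A}"
      using sides cards A(2) B(2) by simp_all
    show "odd n" by (rule odd_n)
    show "even (card X)" using cardX odd_card_inscribed[OF A] odd_card_inscribed[OF B] by simp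
    fix x assume x: "x \<in> X" "c (nxt x) \<in> A \<longleftrightarrow> c x \<in> A"
    have nx: "nxt x \<in> X" using gap(2)[OF x(1)] .
    show "odd (gap x)"
    proof (cases "c x \<in> A")
      case True
      then show ?thesis using odd_gap[OF X_def _ A, of x] x X by simp
    next
      case False
      then have "c x \<in> B" "c (nxt x) \<in> B" using x nx X by auto
      then show ?thesis using odd_gap[OF X_def _ B, of x] x(1) X by simp
    qed
  qed
  then obtain x y where xy: "x \<in> X" "y \<in> X" "x \<noteq> y" "nxt x \<noteq> y" "nxt y \<noteq> x"
    and sw: "(c (nxt x) \<in> A) \<noteq> (c x \<in> A)" "(c (nxt y) \<in> A) \<noteq> (c y \<in> A)"
    and par: "odd (gap x)" "even (gap y)" by blast
  have gapn: "gap x < n" "gap y < n" using gap_less xy by metis+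
  let ?us = "arc x (gap x)" and ?vs = "arc y (gap y)"
  have ends: "hd ?us = c x" "last ?us = c (nxt x)" "hd ?vs = c y" "last ?vs = c (nxt y)"
    using X xy(1,2) by (simp_all add: nxt_def)
  have inter: "(A \<union> B) \<inter> set (arc z (gap z)) = {c z, c (nxt z)}" if "z \<in> X" for z
  proof -
    have "(A \<union> B) \<inter> set (arc z (gap z)) = {c (z mod n), c ((z + gap z) mod n)}"
    proof (rule arc_inter_ends[OF gap(1)[OF that]])
      show "c ((z + j) mod n) \<notin> A \<union> B" if "0 < j" "j < gap z" for j
        using gap_minimal[OF that] X n_pos by simp
    qed (use that gap(2)[OF that] X in \<open>simp_all add: nxt_def\<close>)
    then show ?thesis using that X by (simp add: nxt_def)
  qed
  have disjnt: "set ?us \<inter> set ?vs = {}"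
  proof (rule ccontr)
    assume "\<not> ?thesis"
    then obtain s t where "s \<le> gap x" "t \<le> gap y" "c ((x + s) mod n) = c ((y + t) mod n)"
      unfolding set_arc by blast
    then show False using arcs_disjoint[OF xy, of s t] c_eq_iff n_pos by simp
  qed
  have nX: "nxt x \<in> X" "nxt y \<in> X" using gap(2) xy by auto
  \<comment> \<open>The second arc is reversed when both start in the same clique, so that the seam
    from \<open>last ?us\<close> to \<open>hd vs\<close> stays inside one clique.\<close>
  define vs where "vs = (if c x \<in> A \<longleftrightarrow> c y \<in> A then rev ?vs else ?vs)"
  have vs: "set vs = set ?vs" "distinct vs" "length vs = Suc (gap y)" "vs \<noteq> []"
    using distinct_arc[OF gapn(2)] by (auto simp: vs_def)
  let ?W = "set (?us @ vs)"
  have sub: "set ?us \<subseteq> ?W" "set ?vs \<subseteq> ?W" using vs(1) by auto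
  have succ: "successively (linked \<F> ?W) ?us" by (rule successively_arc[OF sub(1) gapn(1)])
  have "(\<lambda>x y. linked \<F> ?W y x) = linked \<F> ?W" by (intro ext) (rule linked_sym)
  then have "successively (linked \<F> ?W) (rev ?vs)"
    using successively_arc[OF sub(2) gapn(2)] by (simp only: successively_rev)
  moreover have "successively P vs" if "successively P (rev ?vs)" "successively P ?vs" for P
    using that by (simp add: vs_def)
  ultimately have succ': "successively (linked \<F> ?W) vs"
    using successively_arc[OF sub(2) gapn(2)] by blast
  have interW: "(A \<union> B) \<inter> ?W = {c x, c (nxt x), c y, c (nxt y)}"
    using inter[OF xy(1)] inter[OF xy(2)] vs(1) by auto
  have len: "odd (length (?us @ vs))" "3 \<le> length (?us @ vs)"
    using par vs(3) gap(1)[OF xy(1)] gap(1)[OF xy(2)] by auto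
  have ne: "c x \<noteq> c y" "c x \<noteq> c (nxt y)" "c (nxt x) \<noteq> c y" "c (nxt x) \<noteq> c (nxt y)"
    using disjnt inter[OF xy(1)] inter[OF xy(2)] by blast+
  have XB: "c x \<in> B \<longleftrightarrow> c x \<notin> A" "c (nxt x) \<in> B \<longleftrightarrow> c (nxt x) \<notin> A"
    "c y \<in> B \<longleftrightarrow> c y \<notin> A" "c (nxt y) \<in> B \<longleftrightarrow> c (nxt y) \<notin> A"
    using X xy(1,2) nX disj by auto
  have endv: "last vs \<in> A \<longleftrightarrow> c x \<in> A" "hd vs \<in> A \<longleftrightarrow> c x \<notin> A"
    "{last vs, hd vs} = {c y, c (nxt y)}"
    using ends sw(2) by (auto simp: vs_def hd_rev last_rev)
  have endB: "last vs \<in> B \<longleftrightarrow> last vs \<notin> A" "hd vs \<in> B \<longleftrightarrow> hd vs \<notin> A"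
    using endv(3) XB by (auto simp: doubleton_eq_iff)
  have mem: "hd ?us \<in> A \<longleftrightarrow> c x \<in> A" "last ?us \<in> A \<longleftrightarrow> c x \<notin> A"
    "hd ?us \<in> B \<longleftrightarrow> c x \<notin> A" "last ?us \<in> B \<longleftrightarrow> c x \<in> A"
    "last vs \<in> B \<longleftrightarrow> c x \<notin> A" "hd vs \<in> B \<longleftrightarrow> c x \<in> A"
    unfolding ends using sw(1) XB(1,2) endv(1,2) endB by blast+
  have "{hd ?us, last ?us, last vs, hd vs} = {hd ?us, last ?us} \<union> {last vs, hd vs}" by blast
  also have "\<dots> = {c x, c (nxt x), c y, c (nxt y)}" unfolding ends endv(3) by blast
  finally have interW': "(A \<union> B) \<inter> ?W = {hd ?us, last ?us, last vs, hd vs}"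
    using interW by simp
  \<comment> \<open>Interiors of the arcs contain no marked position, so traces on the cycle are
    decided at the four arc ends.\<close>
  have inter4: "P \<inter> ?W = P \<inter> {hd ?us, last ?us, last vs, hd vs}" if "P \<subseteq> A \<union> B" for P
  proof -
    have "P \<inter> ?W = P \<inter> ((A \<union> B) \<inter> ?W)" using that by blast
    then show ?thesis unfolding interW' .
  qed
  have disj': "set ?us \<inter> set vs = {}" using disjnt vs(1) by simp
  have "last vs \<in> set vs" "hd vs \<in> set vs" "last ?us \<in> set ?us" "hd ?us \<in> set ?us"
    by (rule last_in_set hd_in_set arc_simps(2) vs(4))+
  then have lasts: "last vs \<noteq> hd ?us" "last ?us \<noteq> hd vs"
    using disj' by (metis disjoint_iff)+
  note arcs = arc_simps(2) vs(4) distinct_arc[OF gapn(1)] vs(2) disj' len succ succ'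
  have sub_rim: "?W \<subseteq> c ` {..<n}" using set_arc_subset vs(1) by auto
  show False
  proof (cases "c x \<in> A")
    case True
    have AW: "A \<inter> ?W = {last vs, hd ?us}"
      using mem endv(1,2) True by (subst inter4) (simp_all only: Int_insert_right if_True if_False, auto)
    have BW: "B \<inter> ?W = {last ?us, hd vs}"
      using mem endv(1,2) True by (subst inter4) (simp_all only: Int_insert_right if_True if_False, auto)
    have "odd_strong_cycle \<F> (?us @ vs)"
      by (rule odd_strong_cycle_two_arcs[OF A(1) AW lasts(1) B(1) BW lasts(2) arcs])
    then show False by (rule no_odd_strong_cycle[OF A _ sub_rim]) (rule equalityD1[OF AW])
  next
    case False
    have BW: "B \<inter> ?W = {last vs, hd ?us}"
      using mem endv(1,2) False by (subst inter4) (simp_all only: Int_insert_right if_True if_False, auto)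
    have AW: "A \<inter> ?W = {last ?us, hd vs}"
      using mem endv(1,2) False by (subst inter4) (simp_all only: Int_insert_right if_True if_False, auto)
    have "odd_strong_cycle \<F> (?us @ vs)"
      by (rule odd_strong_cycle_two_arcs[OF B(1) BW lasts(1) A(1) AW lasts(2) arcs])
    then show False by (rule no_odd_strong_cycle[OF A _ sub_rim]) (rule equalityD1[OF AW])
  qed
qed

text \<open>If \<open>C\<close> missed \<open>\<xi>\<close>, then \<open>\<xi>\<close> with a point
  of \<open>A \<inter> C\<close> and a point of \<open>B \<inter> C\<close> would form an odd strong
  cycle of length 3, with one side in each clique. This is the source of the common vertex in
  N3.\<close>

lemma three_inscribed_meet:
  assumes A: "A \<in> \<F>" "3 \<le> card A" and B: "B \<in> \<F>" "3 \<le> card B" and C: "C \<in> \<F>" "3 \<le> card C"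
    and "A \<noteq> B" "A \<inter> B = {\<xi>}"
  shows "\<xi> \<in> C"
proof (rule ccontr)
  assume "\<xi> \<notin> C"
  obtain a b where ab: "a \<in> A" "a \<in> C" "b \<in> B" "b \<in> C"
    using inscribed_intersect[OF A C] inscribed_intersect[OF B C] by blast
  have \<xi>: "\<xi> \<in> A" "\<xi> \<in> B" using assms(8) by auto
  have ne: "\<xi> \<noteq> a" "\<xi> \<noteq> b" using ab \<open>\<xi> \<notin> C\<close> by auto
  have nAB: "a \<notin> B" "b \<notin> A" using ab ne assms(8) by auto
  then have "a \<noteq> b" using ab by auto
  have "odd_strong_cycle \<F> [\<xi>, a, b]"
    unfolding odd_strong_cycle_def
    using linkedI[OF A(1), of "{\<xi>, a, b}" \<xi> a] linkedI[OF C(1), of "{\<xi>, a, b}" a b]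
      linkedI[OF B(1), of "{\<xi>, a, b}" b \<xi>] ab \<xi> ne nAB \<open>a \<noteq> b\<close> \<open>\<xi> \<notin> C\<close> by auto
  moreover have "set [\<xi>, a, b] \<subseteq> c ` {..<n}"
    using members[OF A(1)] members[OF B(1)] ab \<xi> by auto
  moreover have "A \<inter> set [\<xi>, a, b] \<subseteq> {\<xi>, a}" using nAB by auto
  ultimately show False by (rule no_odd_strong_cycle[OF A])
qed

end

section \<open>Clique hypergraphs of diamond-free graphs\<close>

abbreviation clique_hypergraph :: "'a set set \<Rightarrow> 'a set \<Rightarrow> 'a set set" where
  "clique_hypergraph E S \<equiv> {Q. max_clique S (induced_edges E S) Q}"

lemma is_clique_induced:
  "is_clique S (induced_edges E S) Q \<longleftrightarrow>
     Q \<noteq> {} \<and> Q \<subseteq> S \<and> (\<forall>u\<in>Q. \<forall>v\<in>Q. u \<noteq> v \<longrightarrow> {u, v} \<in> E)"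
  unfolding is_clique_def induced_edges_def by blast

lemma max_cliqueD:
  assumes "max_clique V E Q"
  shows "is_clique V E Q" "Q \<noteq> {}" "Q \<subseteq> V"
  using assms unfolding max_clique_def is_clique_def by blast+

lemma max_clique_eq: "max_clique V E Q \<Longrightarrow> is_clique V E K \<Longrightarrow> Q \<subseteq> K \<Longrightarrow> K = Q"
  unfolding max_clique_def by blast

text \<open>A vertex \<open>z\<close> of \<open>K\<close> not adjacent to some \<open>q\<close> in
  \<open>Q\<close> would form with \<open>q\<close> the nonadjacent pair of a diamond on the common
  edge \<open>{x, y}\<close>. So \<open>z\<close> extends the clique \<open>Q\<close>, and
  maximality puts it into \<open>Q\<close>.\<close>

lemma clique_subset_max_clique:
  assumes df: "diamond_free V E" and "S \<subseteq> V"
    and Q: "max_clique S (induced_edges E S) Q" and K: "is_clique S (induced_edges E S) K"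
    and xy: "x \<noteq> y" "{x, y} \<subseteq> Q" "{x, y} \<subseteq> K"
  shows "K \<subseteq> Q"
proof
  fix z assume z: "z \<in> K"
  note Qc = max_cliqueD(1)[OF Q, unfolded is_clique_induced]
  note Kc = K[unfolded is_clique_induced]
  have adj: "{z, q} \<in> E" if q: "q \<in> Q" "q \<noteq> z" for q
  proof (rule ccontr)
    assume nadj: "{z, q} \<notin> E"
    then have "z \<notin> {x, y}" "q \<notin> {x, y}"
      using Qc Kc q z xy(2,3) by (auto simp: insert_commute)
    then have "distinct [z, x, y, q]" using xy(1) q(2) by auto
    moreover have "z \<in> V" "x \<in> V" "y \<in> V" "q \<in> V"
      using z q(1) xy(2) Qc Kc assms(2) by auto
    moreover have "{z, x} \<in> E" "{z, y} \<in> E" "{x, y} \<in> E" "{x, q} \<in> E" "{y, q} \<in> E"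
      using Qc Kc q z xy \<open>z \<notin> {x, y}\<close> \<open>q \<notin> {x, y}\<close> by auto
    ultimately show False using df nadj unfolding diamond_free_def by blast
  qed
  have "is_clique S (induced_edges E S) (insert z Q)"
    unfolding is_clique_induced
  proof (intro conjI ballI impI)
    show "insert z Q \<subseteq> S" using Qc Kc z by blast
    fix u v assume uv: "u \<in> insert z Q" "v \<in> insert z Q" "u \<noteq> v"
    then consider "u = z" "v \<in> Q" | "v = z" "u \<in> Q" | "u \<in> Q" "v \<in> Q" by blast
    then show "{u, v} \<in> E"
    proof cases
      case 1
      then show ?thesis using adj[of v] uv(3) by simp
    next
      case 2
      then show ?thesis using adj[of u] uv(3) by (simp add: insert_commute)
    next
      case 3
      then show ?thesis using Qc uv(3) by simp
    qed
  qed simp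
  then have "insert z Q = Q" by (rule max_clique_eq[OF Q _ subset_insertI])
  then show "z \<in> Q" by blast
qed

lemma max_cliques_linear:
  assumes "diamond_free V E" "S \<subseteq> V"
    and "P \<in> clique_hypergraph E S" "Q \<in> clique_hypergraph E S" "{x, y} \<subseteq> P" "{x, y} \<subseteq> Q" "x \<noteq> y"
  shows "P = Q"
proof (rule subset_antisym)
  have P: "max_clique S (induced_edges E S) P" and Q: "max_clique S (induced_edges E S) Q"
    using assms(3,4) by simp_all
  show "P \<subseteq> Q"
    by (rule clique_subset_max_clique[OF assms(1,2) Q max_cliqueD(1)[OF P] assms(7,6,5)])
  show "Q \<subseteq> P"
    by (rule clique_subset_max_clique[OF assms(1,2) P max_cliqueD(1)[OF Q] assms(7,5,6)])
qed

text \<open>A clique within \<open>set ws\<close> containing a trace \<open>{x, y}\<close> lies in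
  the maximal clique that gives this trace, hence equals \<open>{x, y}\<close>. So links stay links
  on the cycle's own vertices, which is what allows a smallest subgraph to be spanned by its
  cycle.\<close>

lemma odd_strong_cycle_induced:
  assumes df: "diamond_free V E" "S \<subseteq> V" and ws: "odd_strong_cycle (clique_hypergraph E S) ws" "set ws \<subseteq> S"
  shows "odd_strong_cycle (clique_hypergraph E (set ws)) ws"
proof -
  let ?W = "set ws"
  have link: "linked (clique_hypergraph E ?W) ?W x y" if xy: "linked (clique_hypergraph E S) ?W x y" for x y
  proof -
    obtain F where F: "max_clique S (induced_edges E S) F" "F \<inter> ?W = {x, y}" "x \<noteq> y"
      using xy unfolding linked_def by blast
    have "x \<in> F" "y \<in> F" using F(2) by blast+
    have "max_clique ?W (induced_edges E ?W) {x, y}"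
      unfolding max_clique_def
    proof (intro conjI allI impI)
      show "is_clique ?W (induced_edges E ?W) {x, y}"
        using max_cliqueD(1)[OF F(1)] F(2) unfolding is_clique_induced by blast
      fix K assume K: "is_clique ?W (induced_edges E ?W) K \<and> {x, y} \<subseteq> K"
      then have "is_clique S (induced_edges E S) K"
        using ws(2) unfolding is_clique_induced by blast
      then have "K \<subseteq> F"
        by (rule clique_subset_max_clique[OF df F(1) _ F(3)]) (use K F(2) in auto)
      moreover have "K \<subseteq> ?W" using K by (simp add: is_clique_induced)
      ultimately have "K \<subseteq> {x, y}" using F(2) by (metis Int_greatest)
      then show "K = {x, y}" using K by (simp add: subset_antisym)
    qed
    moreover have "{x, y} \<inter> ?W = {x, y}" using F(2) by blast
    ultimately show ?thesis using F(3) unfolding linked_def by blast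
  qed
  have "successively (linked (clique_hypergraph E ?W) ?W) ws"
    using ws(1) unfolding odd_strong_cycle_def by (auto intro: successively_mono link)
  then show ?thesis
    using ws(1) link unfolding odd_strong_cycle_def by blast
qed

text \<open>A maximal clique with a single vertex would lie properly inside a clique of size two.
  This raises the condition \<open>card Q \<noteq> 2\<close> on inscribed cliques to size at least
  three.\<close>

lemma two_le_card_max_clique:
  assumes "finite S" and cover: "\<And>v. v \<in> S \<Longrightarrow> \<exists>Q. max_clique S F Q \<and> v \<in> Q \<and> card Q = 2"
    and Q: "max_clique S F Q"
  shows "2 \<le> card Q"
proof (rule ccontr)
  assume small: "\<not> ?thesis"
  have "finite Q" using max_cliqueD(3)[OF Q] assms(1) finite_subset by blast
  obtain v where v: "v \<in> Q" using max_cliqueD(2)[OF Q] by blast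
  have "card Q = 1"
    using small \<open>finite Q\<close> v by (cases "card Q") auto
  then have "Q = {v}" using v by (auto simp: card_1_singleton_iff)
  moreover obtain P where P: "max_clique S F P" "v \<in> P" "card P = 2"
    using cover v max_cliqueD(3)[OF Q] by blast
  ultimately have "P = Q" by (intro max_clique_eq[OF Q max_cliqueD(1)[OF P(1)]]) simp
  then show False using \<open>card Q = 1\<close> P(3) by simp
qed

section \<open>Clique-transversal and clique-independence numbers\<close>

lemma finite_transversals: "finite V \<Longrightarrow> finite {T. clique_transversal V E T}"
  by (rule finite_subset[of _ "Pow V"]) (auto simp: clique_transversal_def)

lemma finite_independents: "finite V \<Longrightarrow> finite {F. clique_independent V E F}"
  by (rule finite_subset[of _ "Pow (Pow V)"]) (auto simp: clique_independent_def dest: max_cliqueD(3))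

text \<open>The whole vertex set is a transversal because maximal cliques are nonempty, so
  \<open>Min\<close> is taken over a nonempty finite set.\<close>

lemma tau_c_attained:
  assumes "finite V"
  obtains T where "clique_transversal V E T" "card T = tau_c V E"
proof -
  have "clique_transversal V E V"
    unfolding clique_transversal_def using max_cliqueD by blast
  then have "tau_c V E \<in> card ` {T. clique_transversal V E T}"
    unfolding tau_c_def using finite_transversals[OF assms] by (intro Min_in) auto
  then show thesis using that by auto
qed

lemma tau_c_le: "finite V \<Longrightarrow> clique_transversal V E T \<Longrightarrow> tau_c V E \<le> card T"
  unfolding tau_c_def by (rule Min_le) (auto intro: finite_transversals)

lemma alpha_c_attained:
  assumes "finite V"
  obtains F where "clique_independent V E F" "card F = alpha_c V E"
proof -
  have "clique_independent V E {}" by (simp add: clique_independent_def)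
  then have "alpha_c V E \<in> card ` {F. clique_independent V E F}"
    unfolding alpha_c_def using finite_independents[OF assms] by (intro Max_in) auto
  then show thesis using that by auto
qed

lemma alpha_c_ge: "finite V \<Longrightarrow> clique_independent V E F \<Longrightarrow> card F \<le> alpha_c V E"
  unfolding alpha_c_def by (rule Max_ge) (auto intro: finite_independents)

text \<open>Choosing a point of the transversal in each clique is injective because the cliques are
  disjoint.\<close>

lemma alpha_c_le_tau_c:
  assumes "finite V"
  shows "alpha_c V E \<le> tau_c V E"
proof -
  obtain T where T: "clique_transversal V E T" "card T = tau_c V E" using tau_c_attained[OF assms] .
  obtain F where F: "clique_independent V E F" "card F = alpha_c V E" using alpha_c_attained[OF assms] .
  have "\<forall>Q\<in>F. \<exists>t. t \<in> T \<inter> Q"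
    using T(1) F(1) unfolding clique_transversal_def clique_independent_def by blast
  then obtain t where t: "\<And>Q. Q \<in> F \<Longrightarrow> t Q \<in> T \<inter> Q" by metis
  have "inj_on t F"
  proof (rule inj_onI)
    fix P Q assume PQ: "P \<in> F" "Q \<in> F" "t P = t Q"
    then have "t P \<in> P \<inter> Q" using t[OF PQ(1)] t[OF PQ(2)] PQ(3) by simp
    then show "P = Q"
      using F(1) PQ(1,2) unfolding clique_independent_def pairwise_def disjnt_def by blast
  qed
  moreover have "t ` F \<subseteq> T" using t by blast
  moreover have "finite T" using T(1) assms finite_subset unfolding clique_transversal_def by blast
  ultimately have "card F \<le> card T" by (rule card_inj_on_le)
  then show ?thesis using T(2) F(2) by simp
qed

lemma balanced_imp_tau_c_eq_alpha_c:
  assumes "finite V" "balanced V {Q. max_clique V E Q} (\<in>)"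
  shows "tau_c V E = alpha_c V E"
proof -
  have "finite {Q. max_clique V E Q}"
    by (rule finite_subset[of _ "Pow V"]) (use assms(1) in \<open>auto dest: max_cliqueD(3)\<close>)
  moreover have "Q \<subseteq> V \<and> Q \<noteq> {}" if "Q \<in> {Q. max_clique V E Q}" for Q
    using that max_cliqueD by blast
  ultimately obtain T F where TF: "T \<subseteq> V" "\<forall>Q\<in>{Q. max_clique V E Q}. T \<inter> Q \<noteq> {}"
    "F \<subseteq> {Q. max_clique V E Q}" "pairwise disjnt F" "card T \<le> card F"
    using balanced_koenig[OF assms(1) _ _ assms(2)] by blast
  have "tau_c V E \<le> card T"
    using TF(1,2) by (intro tau_c_le[OF assms(1)]) (simp add: clique_transversal_def)
  also have "\<dots> \<le> card F" by (rule TF(5))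
  also have "\<dots> \<le> alpha_c V E"
    using TF(3,4) by (intro alpha_c_ge[OF assms(1)]) (auto simp: clique_independent_def)
  finally show ?thesis using alpha_c_le_tau_c[OF assms(1), of E] by simp
qed

text \<open>A transversal must contain more than half of the vertices of an odd rim, whereas disjoint cliques
  with at least two vertices each number at most half.\<close>

lemma odd_rim_tau_c_neq_alpha_c:
  assumes "finite S" "odd (card S)" "1 < card S" and bij: "bij_betw c {0..<card S} S"
    and rim: "\<And>i. i < card S \<Longrightarrow> max_clique S F {c i, c (Suc i mod card S)}"
  shows "tau_c S F \<noteq> alpha_c S F"
proof -
  let ?n = "card S"
  have c: "c i = c j \<longleftrightarrow> i = j" if "i < ?n" "j < ?n" for i j
    using bij that by (auto simp: bij_betw_def inj_on_def)
  have cS: "c ` {0..<?n} = S" using bij by (simp add: bij_betw_def)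
  have card2: "2 \<le> card Q" if Q: "max_clique S F Q" for Q
  proof (rule two_le_card_max_clique[OF assms(1) _ Q])
    fix v assume "v \<in> S"
    then have "v \<in> c ` {0..<?n}" using cS by simp
    then obtain i where i: "i < ?n" "v = c i" by auto
    have "Suc i mod ?n < ?n" using i(1) by simp
    moreover have "Suc i mod ?n \<noteq> i" using i(1) assms(3) by (auto simp: mod_Suc split: if_splits)
    ultimately have "c i \<noteq> c (Suc i mod ?n)" using c[OF i(1)] by metis
    then show "\<exists>Q. max_clique S F Q \<and> v \<in> Q \<and> card Q = 2"
      using rim[OF i(1)] i(2) by (intro exI[of _ "{c i, c (Suc i mod ?n)}"]) simp
  qed
  obtain \<A> where \<A>: "clique_independent S F \<A>" "card \<A> = alpha_c S F"
    using alpha_c_attained[OF assms(1)] .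
  have mem: "max_clique S F Q" if "Q \<in> \<A>" for Q
    using \<A>(1) that unfolding clique_independent_def by blast
  have "2 * card \<A> = (\<Sum>Q\<in>\<A>. 2)" by simp
  also have "\<dots> \<le> (\<Sum>Q\<in>\<A>. card Q)" by (rule sum_mono) (use card2 mem in blast)
  also have "\<dots> = card (\<Union>\<A>)"
  proof (rule card_Union_disjoint[symmetric])
    show "pairwise disjnt \<A>" using \<A>(1) by (simp add: clique_independent_def)
    show "finite Q" if "Q \<in> \<A>" for Q
      using max_cliqueD(3)[OF mem[OF that]] assms(1) finite_subset by blast
  qed
  also have "\<dots> \<le> ?n"
    using max_cliqueD(3) mem by (intro card_mono[OF assms(1)]) blast
  finally have alpha: "2 * alpha_c S F \<le> ?n" using \<A>(2) by simp
  obtain T where T: "clique_transversal S F T" "card T = tau_c S F"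
    using tau_c_attained[OF assms(1)] .
  define X where "X = {i. i < ?n \<and> c i \<in> T}"
  \<comment> \<open>\<open>Y\<close> is \<open>X\<close> moved back by one place. The rim edge at
    \<open>i\<close> is met at its first end if \<open>i\<close> is in \<open>X\<close> and at its
    second if \<open>i\<close> is in \<open>Y\<close>, so the two sets cover all positions.\<close>
  define Y where "Y = {i. i < ?n \<and> Suc i mod ?n \<in> X}"
  have "finite X" "finite Y" by (simp_all add: X_def Y_def)
  have "inj_on c X"
    using bij unfolding bij_betw_def by (rule inj_on_subset[OF conjunct1]) (auto simp: X_def)
  moreover have "T \<subseteq> c ` {0..<?n}"
    using T(1) unfolding cS clique_transversal_def by simp
  then have "c ` X = T" unfolding X_def by auto
  ultimately have cardX: "card X = card T" by (metis card_image)
  have "card Y \<le> card X"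
  proof (rule card_inj_on_le[OF _ _ \<open>finite X\<close>])
    show "inj_on (\<lambda>i. Suc i mod ?n) Y"
      by (rule inj_onI) (auto simp: Y_def mod_Suc split: if_splits)
    show "(\<lambda>i. Suc i mod ?n) ` Y \<subseteq> X" by (auto simp: Y_def)
  qed
  have "{..<?n} \<subseteq> X \<union> Y"
  proof
    fix i assume "i \<in> {..<?n}"
    then have i: "i < ?n" "Suc i mod ?n < ?n" by simp_all
    then have "T \<inter> {c i, c (Suc i mod ?n)} \<noteq> {}"
      using T(1) rim unfolding clique_transversal_def by blast
    then show "i \<in> X \<union> Y" using i by (auto simp: X_def Y_def)
  qed
  then have "card {..<?n} \<le> card (X \<union> Y)"
    using \<open>finite X\<close> \<open>finite Y\<close> by (intro card_mono finite_UnI)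
  also have "\<dots> \<le> card X + card Y" by (rule card_Un_le)
  finally have "?n \<le> card X + card Y" unfolding card_lessThan .
  then have "?n \<le> 2 * tau_c S F" using cardX T(2) \<open>card Y \<le> card X\<close> by linarith
  then show ?thesis using alpha assms(2) by presburger
qed

section \<open>Odd holes and sunoids violate the equality\<close>

lemma sunoid_imp_tau_c_neq_alpha_c:
  assumes "finite S" "sunoid S F"
  shows "tau_c S F \<noteq> alpha_c S F"
proof -
  obtain c where c: "multisun_rim S F c" using assms(2) unfolding sunoid_def by blast
  have rim: "{Q. max_clique S F Q \<and> card Q = 2} = rim_edges c (card S)"
    using c unfolding multisun_rim_def by simp
  have "max_clique S F {c i, c (Suc i mod card S)}" if "i < card S" for i
  proof -
    have "{c i, c (Suc i mod card S)} \<in> rim_edges c (card S)"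
      using that unfolding rim_edges_def by blast
    then show ?thesis unfolding rim[symmetric] by simp
  qed
  moreover have "odd (card S)" "1 < card S" "bij_betw c {0..<card S} S"
    using c unfolding multisun_rim_def by simp_all
  ultimately show ?thesis
    using odd_rim_tau_c_neq_alpha_c[OF assms(1)] by simp
qed

lemma odd_hole_imp_tau_c_neq_alpha_c:
  assumes "finite S" "odd_hole S F"
  shows "tau_c S F \<noteq> alpha_c S F"
proof -
  let ?n = "card S"
  from assms(2)[unfolded odd_hole_def] obtain c where c: "odd ?n" "5 \<le> ?n" "bij_betw c {0..<?n} S"
    and adj: "\<forall>i<?n. \<forall>j<?n. {c i, c j} \<in> F \<longleftrightarrow> j = Suc i mod ?n \<or> i = Suc j mod ?n"
    by (elim exE conjE)
  have cS: "c ` {0..<?n} = S" using c(3) by (simp add: bij_betw_def)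
  show ?thesis
  proof (rule odd_rim_tau_c_neq_alpha_c[OF assms(1) c(1) _ c(3)])
    fix i assume i: "i < ?n"
    let ?j = "Suc i mod ?n"
    have j: "?j < ?n" using i by simp
    show "max_clique S F {c i, c ?j}"
      unfolding max_clique_def
    proof (intro conjI allI impI)
      have e: "{c i, c ?j} \<in> F" using adj[rule_format, OF i j] by simp
      then have "{c ?j, c i} \<in> F" by (simp only: insert_commute)
      moreover have "c i \<in> S" "c ?j \<in> S"
        using i j c(3) unfolding bij_betw_def by auto
      ultimately show "is_clique S F {c i, c ?j}"
        using e unfolding is_clique_def by simp
      fix K assume K: "is_clique S F K \<and> {c i, c ?j} \<subseteq> K"
      have "z \<in> {c i, c ?j}" if z: "z \<in> K" for z
      proof (rule ccontr)
        assume "\<not> ?thesis"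
        then have ne: "z \<noteq> c i" "z \<noteq> c ?j" by auto
        have "z \<in> c ` {0..<?n}" using z K unfolding cS is_clique_def by blast
        then obtain l where l: "l < ?n" "z = c l" by auto
        have "{c i, c l} \<in> F" "{c ?j, c l} \<in> F"
          using K z ne unfolding is_clique_def l(2)[symmetric] by simp_all
        then have *: "l = ?j \<or> i = Suc l mod ?n" "l = Suc ?j mod ?n \<or> ?j = Suc l mod ?n"
          using adj[rule_format, OF i l(1)] adj[rule_format, OF j l(1)] by simp_all
        have "l \<noteq> i" "l \<noteq> ?j" using ne l(2) by auto
        then have il: "i = Suc l mod ?n" using *(1) by simp
        show False
        proof (cases "?j = Suc l mod ?n")
          case True
          then have "(1 + i) mod ?n = (1 + l) mod ?n" by simp
          then have "i = l" by (rule add_mod_inj[OF _ i l(1)])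
          then show False using \<open>l \<noteq> i\<close> by simp
        next
          case False
          then have l2: "l = Suc ?j mod ?n" using *(2) by simp
          \<comment> \<open>Going from \<open>i\<close> via \<open>?j\<close> and \<open>l\<close>
            back to \<open>i\<close> takes three cyclic steps, impossible on a cycle of length at
            least 5.\<close>
          have "Suc l mod ?n = Suc (Suc (Suc i)) mod ?n"
            by (subst l2) (simp only: mod_Suc_eq)
          then have "(i + 3) mod ?n = (i + 0) mod ?n" using i il by (simp add: numeral_3_eq_3)
          then have "3 = (0::nat)" by (rule add_mod_inj) (use c(2) in simp_all)
          then show False by simp
        qed
      qed
      then show "K = {c i, c ?j}" using K by blast
    qed
  qed (use c(2) in simp)
qed

text \<open>The cycle uses all of \<open>S\<close>, so traces on \<open>S\<close> are the cliques
  themselves. Consecutive vertices of \<open>ws\<close> therefore form maximal cliques of size two,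
  and \<open>ws\<close> itself serves as the rim.\<close>

lemma minimal_odd_strong_cycle_sunoid:
  assumes df: "diamond_free V E" and S: "S \<subseteq> V"
    and ws: "odd_strong_cycle (clique_hypergraph E S) ws" "set ws = S"
    and minimal: "\<And>us. odd_strong_cycle (clique_hypergraph E S) us \<Longrightarrow> set us \<subseteq> S \<Longrightarrow> S \<subseteq> set us"
  shows "sunoid S (induced_edges E S)"
proof -
  let ?E = "induced_edges E S" and ?n = "card S" and ?c = "(!) ws"
  have finS: "finite S" using ws(2) by (metis List.finite_set)
  have dist: "distinct ws" "odd (length ws)" "3 \<le> length ws"
    using ws(1) unfolding odd_strong_cycle_def by blast+
  have n: "?n = length ws" using ws(2) dist(1) distinct_card by metis
  have n3: "odd ?n" "3 \<le> ?n" using n dist by simp_all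
  have bij: "bij_betw ?c {0..<?n} S"
    using bij_betw_nth[OF dist(1)] n ws(2) by (simp add: atLeast0LessThan)
  have cS: "?c ` {..<?n} = S" and inj: "inj_on ?c {..<?n}"
    using bij by (simp_all add: bij_betw_def atLeast0LessThan)
  have rim_edge: "{?c i, ?c (Suc i mod ?n)} \<in> clique_hypergraph E S" "?c i \<noteq> ?c (Suc i mod ?n)" if i: "i < ?n" for i
  proof -
    have "linked (clique_hypergraph E S) S (?c i) (?c (Suc i mod ?n))"
      using cyclic_nth[of "linked (clique_hypergraph E S) S" ws i] ws i n
      unfolding odd_strong_cycle_def by simp
    then obtain Q where Q: "Q \<in> clique_hypergraph E S" "Q \<inter> S = {?c i, ?c (Suc i mod ?n)}"
      and ne: "?c i \<noteq> ?c (Suc i mod ?n)"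
      unfolding linked_def by blast
    have "Q \<inter> S = Q" using max_cliqueD(3) Q(1) by blast
    then show "{?c i, ?c (Suc i mod ?n)} \<in> clique_hypergraph E S" using Q by simp
    show "?c i \<noteq> ?c (Suc i mod ?n)" by (rule ne)
  qed
  interpret minimal_rim ?n ?c "clique_hypergraph E S"
  proof
    show "Q \<subseteq> ?c ` {..<?n}" if "Q \<in> clique_hypergraph E S" for Q
      using that max_cliqueD(3) unfolding cS by blast
    show "P = Q" if "P \<in> clique_hypergraph E S" "Q \<in> clique_hypergraph E S"
      "{x, y} \<subseteq> P" "{x, y} \<subseteq> Q" "x \<noteq> y" for P Q x y
      by (rule max_cliques_linear[OF df S that])
    show "?c ` {..<?n} \<subseteq> set us"
      if "odd_strong_cycle (clique_hypergraph E S) us" "set us \<subseteq> ?c ` {..<?n}" for us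
      using minimal that unfolding cS by blast
  qed (use n3 inj rim_edge(1) in auto)
  have rim_card: "card {?c i, ?c (Suc i mod ?n)} = 2" if "i < ?n" for i
    using rim_edge(2)[OF that] by simp
  have ins: "A \<in> clique_hypergraph E S" "3 \<le> card A" if "A \<in> inscribed_cliques S ?E" for A
  proof -
    show A: "A \<in> clique_hypergraph E S" using that by (simp add: inscribed_cliques_def)
    have "2 \<le> card A"
    proof (rule two_le_card_max_clique[OF finS])
      fix v assume "v \<in> S"
      then have "v \<in> ?c ` {..<?n}" using cS by simp
      then obtain i where i: "i < ?n" "v = ?c i" by auto
      show "\<exists>Q. max_clique S ?E Q \<and> v \<in> Q \<and> card Q = 2"
      proof (intro exI conjI)
        show "max_clique S ?E {?c i, ?c (Suc i mod ?n)}" using rim_edge(1)[OF i(1)] by (rule CollectD)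
        show "card {?c i, ?c (Suc i mod ?n)} = 2" by (rule rim_card[OF i(1)])
      qed (simp add: i(2))
    qed (rule CollectD[OF A])
    moreover have "card A \<noteq> 2" using that by (simp add: inscribed_cliques_def)
    ultimately show "3 \<le> card A" by simp
  qed
  have "diamond_free S ?E"
  proof -
    have "\<not> (\<exists>a\<in>S. \<exists>b\<in>S. \<exists>c\<in>S. \<exists>d\<in>S. distinct [a, b, c, d] \<and>
      {a, b} \<in> E \<and> {a, c} \<in> E \<and> {b, c} \<in> E \<and> {b, d} \<in> E \<and> {c, d} \<in> E \<and> {a, d} \<notin> E)"
      using df S unfolding diamond_free_def by blast
    moreover have "{a, b} \<in> ?E \<longleftrightarrow> {a, b} \<in> E" if "a \<in> S" "b \<in> S" for a b
      using that by (simp add: induced_edges_def)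
    ultimately show ?thesis unfolding diamond_free_def by simp
  qed
  moreover have "{Q. max_clique S ?E Q \<and> card Q = 2} = rim_edges ?c ?n"
    using card_2_imp_rim rim_edge(1) rim_card unfolding rim_edges_def by auto
  moreover have "{u, v} \<notin> rim_edges ?c ?n"
    if Q: "max_clique S ?E Q \<and> card Q \<noteq> 2" "u \<in> Q" "v \<in> Q" "u \<noteq> v" for Q u v
  proof
    assume "{u, v} \<in> rim_edges ?c ?n"
    then obtain i where i: "i < ?n" "{u, v} = {?c i, ?c (Suc i mod ?n)}"
      unfolding rim_edges_def by blast
    have "{u, v} \<in> clique_hypergraph E S" using rim_edge(1)[OF i(1)] i(2) by simp
    then have "{u, v} = Q" using Q by (intro linear[of _ _ u v]) auto
    then show False using Q by auto
  qed
  ultimately have msun: "multisun_rim S ?E ?c"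
    using n3 bij unfolding multisun_rim_def by blast
  \<comment> \<open>An arbitrary subfamily is treated, which handles the multisun and all its
    sub-multisuns together: the lemmas on arcs only ask that interiors avoid the one or two cliques
    concerned.\<close>
  have "N_conditions S ?c Ins" if Ins: "Ins \<subseteq> inscribed_cliques S ?E" for Ins
  proof -
    have A: "A \<in> clique_hypergraph E S" "3 \<le> card A" if "A \<in> Ins" for A
      using ins Ins that by blast+
    have N1': "odd k \<and> 3 \<le> k"
      if "A \<in> Ins" "rim_path S ?c Ins i k" "?c i \<in> A" "?c ((i + k) mod ?n) \<in> A" for A i k
      using that(2) AA_path_length[OF A[OF that(1)], of k i] that(1,3,4) unfolding rim_path_def by blast
    have inter: "\<exists>\<xi>. A \<inter> B = {\<xi>}" if AB: "A \<in> Ins" "B \<in> Ins" "A \<noteq> B" for A B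
    proof -
      obtain \<xi> where \<xi>: "\<xi> \<in> A \<inter> B" using inscribed_intersect[OF A[OF AB(1)] A[OF AB(2)]] by blast
      have "x = \<xi>" if "x \<in> A \<inter> B" for x
        using linear[OF A(1)[OF AB(1)] A(1)[OF AB(2)], of x \<xi>] that \<xi> AB(3) by auto
      then show ?thesis using \<xi> by blast
    qed
    have N3: "\<exists>\<xi>\<in>S. (\<forall>A\<in>Ins. \<xi> \<in> A) \<and> (\<forall>A\<in>Ins. \<forall>B\<in>Ins. A \<noteq> B \<longrightarrow> A \<inter> B = {\<xi>})"
    proof (cases "\<exists>A\<in>Ins. \<exists>B\<in>Ins. A \<noteq> B")
      case True
      then obtain A B where AB: "A \<in> Ins" "B \<in> Ins" "A \<noteq> B" by blast
      obtain \<xi> where \<xi>: "A \<inter> B = {\<xi>}" using inter[OF AB] by (rule exE)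
      have all: "\<xi> \<in> C" if "C \<in> Ins" for C
        by (rule three_inscribed_meet[OF A[OF AB(1)] A[OF AB(2)] A[OF that] AB(3) \<xi>])
      have "C \<inter> D = {\<xi>}" if "C \<in> Ins" "D \<in> Ins" "C \<noteq> D" for C D
        using inter[OF that] all[OF that(1)] all[OF that(2)] by (metis IntI singletonD)
      moreover have "\<xi> \<in> S" using members[OF A(1)[OF AB(1)]] all[OF AB(1)] cS by blast
      ultimately show ?thesis using all by (intro bexI[of _ \<xi>]) simp_all
    next
      \<comment> \<open>With at most one inscribed clique any rim vertex, respectively any vertex of
        that clique, serves as \<open>\<xi>\<close>.\<close>
      case False
      then consider "Ins = {}" | A where "Ins = {A}" by blast
      then show ?thesis
      proof cases
        case 1
        have "S \<noteq> {}" using n3(2) by auto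
        then show ?thesis using 1 by blast
      next
        case 2
        then have "max_clique S ?E A" using A(1)[of A] by simp
        then have "A \<noteq> {}" "A \<subseteq> S" by (rule max_cliqueD)+
        then show ?thesis using 2 by blast
      qed
    qed
    have N5': "even k"
      if P: "A \<in> Ins" "B \<in> Ins" "A \<noteq> B" "rim_path S ?c Ins i k" "?c i \<in> A - B" "?c ((i + k) mod ?n) \<in> B - A"
      for A B i k
    proof -
      obtain \<xi> where \<xi>: "A \<inter> B = {\<xi>}" using inter P(1-3) by blast
      show ?thesis
        by (rule even_AB_path_length[OF A[OF P(1)] A(1)[OF P(2)] \<xi> _ _ P(5,6)])
          (use P(1,2,4) in \<open>auto simp: rim_path_def\<close>)
    qed
    obtain \<xi> where \<xi>: "\<xi> \<in> S" "\<forall>A\<in>Ins. \<xi> \<in> A" "\<forall>A\<in>Ins. \<forall>B\<in>Ins. A \<noteq> B \<longrightarrow> A \<inter> B = {\<xi>}"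
      using N3 by blast
    \<comment> \<open>Since \<open>\<xi>\<close> lies in \<open>A\<close>, such a path is an
      \<open>A\<close>-path and N1 gives its parity.\<close>
    have N4: "even (k + 1)" if "A \<in> Ins" "rim_path S ?c Ins i k"
      "(?c i \<in> A \<and> ?c ((i + k) mod ?n) = \<xi>) \<or> (?c i = \<xi> \<and> ?c ((i + k) mod ?n) \<in> A)" for A i k
      using N1'[OF that(1,2)] that(1,3) \<xi>(2) by auto
    show ?thesis
      unfolding N_conditions_def
    proof (intro conjI ballI allI impI bexI[OF _ \<xi>(1)])
      show "odd (card A)" if "A \<in> Ins" for A by (rule odd_card_inscribed[OF A[OF that]])
      show "even (k + 1)" "4 \<le> k + 1" if "A \<in> Ins"
        "rim_path S ?c Ins i k \<and> ?c i \<in> A \<and> ?c ((i + k) mod ?n) \<in> A" for A i k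
        using N1'[of A i k] that by auto
      show "\<xi> \<in> A" if "A \<in> Ins" for A using \<xi>(2) that by blast
      show "A \<inter> B = {\<xi>}" if "A \<in> Ins" "B \<in> Ins" "A \<noteq> B" for A B using \<xi>(3) that by blast
      show "even (k + 1)" if "A \<in> Ins" "rim_path S ?c Ins i k \<and>
        ((?c i \<in> A \<and> ?c ((i + k) mod ?n) = \<xi>) \<or> (?c i = \<xi> \<and> ?c ((i + k) mod ?n) \<in> A))" for A i k
        using N4[OF that(1)] that(2) by blast
      show "odd (k + 1)" if "A \<in> Ins" "B \<in> Ins" "A \<noteq> B" "rim_path S ?c Ins i k \<and>
        ?c i \<in> A - B \<and> ?c ((i + k) mod ?n) \<in> B - A" for A B i k
        using N5'[OF that(1-3), of i k] that(4) by simp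
    qed
  qed
  then show ?thesis using msun unfolding sunoid_def by blast
qed

theorem theorem11:
  fixes V :: "'a set" and E :: "'a set set"
  assumes "finite V"
    and "\<forall>e\<in>E. e \<subseteq> V \<and> card e = 2"
    and "diamond_free V E"
  shows "clique_perfect V E \<longleftrightarrow>
    (\<forall>S \<subseteq> V. \<not> odd_hole S (induced_edges E S) \<and> \<not> sunoid S (induced_edges E S))"
proof
  assume perfect: "clique_perfect V E"
  show "\<forall>S \<subseteq> V. \<not> odd_hole S (induced_edges E S) \<and> \<not> sunoid S (induced_edges E S)"
  proof (intro allI impI)
    fix S assume "S \<subseteq> V"
    then have "finite S" "tau_c S (induced_edges E S) = alpha_c S (induced_edges E S)"
      using perfect assms(1) finite_subset unfolding clique_perfect_def by auto
    then show "\<not> odd_hole S (induced_edges E S) \<and> \<not> sunoid S (induced_edges E S)"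
      using odd_hole_imp_tau_c_neq_alpha_c[of S] sunoid_imp_tau_c_neq_alpha_c[of S] by auto
  qed
next
  assume no_sunoid: "\<forall>S \<subseteq> V. \<not> odd_hole S (induced_edges E S) \<and> \<not> sunoid S (induced_edges E S)"
  define bad where "bad S \<longleftrightarrow> S \<subseteq> V \<and> (\<exists>ws. odd_strong_cycle (clique_hypergraph E S) ws \<and> set ws \<subseteq> S)" for S
  have not_bad: "\<not> bad S" for S
  proof
    assume "bad S"
    then obtain M where M: "bad M" and least: "\<forall>S. bad S \<longrightarrow> card M \<le> card S"
      using ex_has_least_nat[of bad S card] by blast
    have "M \<subseteq> V" using M by (simp add: bad_def)
    then have "finite M" using assms(1) finite_subset by blast
    have full: "set us = M" if us: "odd_strong_cycle (clique_hypergraph E M) us" "set us \<subseteq> M" for us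
    proof -
      \<comment> \<open>The vertices of the cycle induce a subgraph that contains the same cycle as
        an odd strong cycle, so a smaller \<open>set us\<close> would contradict the choice of
        \<open>M\<close>.\<close>
      have "bad (set us)"
        using odd_strong_cycle_induced[OF assms(3) \<open>M \<subseteq> V\<close> us] us(2) \<open>M \<subseteq> V\<close> unfolding bad_def by blast
      then have "card M \<le> card (set us)" using least by simp
      then show ?thesis by (rule card_seteq[OF \<open>finite M\<close> us(2)])
    qed
    obtain ws where ws: "odd_strong_cycle (clique_hypergraph E M) ws" "set ws \<subseteq> M"
      using M unfolding bad_def by blast
    have "sunoid M (induced_edges E M)"
      by (rule minimal_odd_strong_cycle_sunoid[OF assms(3) \<open>M \<subseteq> V\<close> ws(1) full[OF ws]])
        (simp add: full)
    then show False using no_sunoid \<open>M \<subseteq> V\<close> by blast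
  qed
  show "clique_perfect V E"
    unfolding clique_perfect_def
  proof (intro allI impI)
    fix S assume S: "S \<subseteq> V"
    have "balanced S (clique_hypergraph E S) (\<in>)"
    proof (rule ccontr)
      assume "\<not> ?thesis"
      then obtain ws where "set ws \<subseteq> S" "odd_strong_cycle (clique_hypergraph E S) ws"
        by (rule unbalanced_imp_odd_strong_cycle)
      then show False using not_bad[of S] S unfolding bad_def by blast
    qed
    then show "tau_c S (induced_edges E S) = alpha_c S (induced_edges E S)"
      by (rule balanced_imp_tau_c_eq_alpha_c[OF finite_subset[OF S assms(1)]])
  qed
qed

end
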